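(* Consider the following two lists of moves on virtual braids. List K (Kamada's moves): 1. conjugation: $b\sim g^{-1}bg$ for $b,g\in VB_n$; 2. right stabilization: $b\sim b\sigma_n$, $b\sim b\sigma_n^{-1}$, $b\sim bv_n$, for $b\in VB_n$ (right-hand sides in $VB_{n+1}$); 3. right exchange move: $b_1\sigma_n^{-1}b_2\sigma_n\sim b_1v_nb_2v_n$ for $b_1,b_2\in VB_n$ (both sides in $VB_{n+1}$); 4. left exchange move: $i(b_1)\sigma_1^{-1}i(b_2)\sigma_1\sim i(b_1)v_1i(b_2)v_1$ for $b_1,b_2\in VB_n$ (both sides in $VB_{n+1}$). List A: (i) virtual and real conjugation: $v_i\alpha v_i\sim\alpha\sim\sigma_i^{-1}\alpha\sigma_i$; (ii) right virtual and real stabilization: $\alpha v_n\sim\alpha\sim\alpha\sigma_n^{\pm1}$; (iii) algebraic right under-threading: $\alpha\sim\alpha\sigma_n^{-1}v_{n-1}\sigma_n$; (iv) algebraic left under-threading: $\alpha\sim\alpha v_nv_{n-1}\sigma_{n-1}v_n\sigma_{n-1}^{-1}v_{n-1}v_n$, where $\alpha,v_i,\sigma_i\in VB_n$ and $v_n,\sigma_n\in VB_{n+1}$. Then every move of List K can be realized by a finite sequence of braid relations in $VB_\infty$ and moves of List A or their inverses. Conversely, every move of List A can be realized by a finite sequence of braid relations in $VB_\infty$ and moves of List K or their inverses.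
   Context: The virtual braid group $VB_n$ has generators $\sigma_i, v_i$, $1\le i\le n-1$, and relations: $\sigma_i\sigma_{i+1}\sigma_i=\sigma_{i+1}\sigma_i\sigma_{i+1}$; $v_iv_{i+1}v_i=v_{i+1}v_iv_{i+1}$; $v_i^2=1$; $\sigma_i\sigma_j=\sigma_j\sigma_i$, $v_iv_j=v_jv_i$, $\sigma_iv_j=v_j\sigma_i$ for $|i-j|>1$; $v_i\sigma_{i+1}v_i=v_{i+1}\sigma_iv_{i+1}$. $VB_n$ is included in $VB_{n+1}$ by adding an identity strand at the right (generators keep their index), and elements of $VB_n$ are regarded in $VB_{n+1}$ in this way when needed. $VB_\infty=\bigcup_{n\ge1}VB_n$ is the disjoint union of all virtual braid groups. For $b\in VB_n$, $i(b)\in VB_{n+1}$ denotes the element obtained by adding one to the index of every generator in $b$ (adding an identity strand at the left). The index $n$ in the moves is arbitrary, subject to all generators appearing being defined. *)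

theory Defs
  imports "HOL-Algebra.Group"
begin

section \<open>The virtual braid groups\<close>

datatype vb_gen = Sig nat | Virt nat

text \<open>
  A letter \<open>(x, True)\<close> is the generator \<open>x\<close>, and \<open>(x, False)\<close> is its formal inverse.
\<close>

type_synonym vb_letter = "vb_gen \<times> bool"
type_synonym vb_word = "vb_letter list"

fun gen_index :: "vb_gen \<Rightarrow> nat" where
  "gen_index (Sig i) = i"
| "gen_index (Virt i) = i"

definition vb_words :: "nat \<Rightarrow> vb_word set" where
  "vb_words n = lists {(x, e). 1 \<le> gen_index x \<and> gen_index x < n}"

abbreviation s_word :: "nat \<Rightarrow> vb_word" where "s_word i \<equiv> [(Sig i, True)]"
abbreviation v_word :: "nat \<Rightarrow> vb_word" where "v_word i \<equiv> [(Virt i, True)]"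

text \<open>
  The rules \<open>inv_right\<close> and \<open>inv_left\<close> are free reduction; the others are the defining relations
  of \<open>VB\<^sub>n\<close>. Far commutativity is stated for \<open>i\<close>, \<open>j\<close> in either order.
\<close>

inductive vb_relation :: "nat \<Rightarrow> vb_word \<Rightarrow> vb_word \<Rightarrow> bool" for n :: nat where
  inv_right: "1 \<le> gen_index x \<Longrightarrow> gen_index x < n \<Longrightarrow> vb_relation n [(x, True), (x, False)] []"
| inv_left: "1 \<le> gen_index x \<Longrightarrow> gen_index x < n \<Longrightarrow> vb_relation n [(x, False), (x, True)] []"
| sss: "1 \<le> i \<Longrightarrow> i + 1 < n \<Longrightarrow>
    vb_relation n (s_word i @ s_word (i+1) @ s_word i) (s_word (i+1) @ s_word i @ s_word (i+1))"
| vvv: "1 \<le> i \<Longrightarrow> i + 1 < n \<Longrightarrow>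
    vb_relation n (v_word i @ v_word (i+1) @ v_word i) (v_word (i+1) @ v_word i @ v_word (i+1))"
| vv: "1 \<le> i \<Longrightarrow> i < n \<Longrightarrow> vb_relation n (v_word i @ v_word i) []"
| ss_comm: "1 \<le> i \<Longrightarrow> i < n \<Longrightarrow> 1 \<le> j \<Longrightarrow> j < n \<Longrightarrow> \<bar>int i - int j\<bar> > 1 \<Longrightarrow>
    vb_relation n (s_word i @ s_word j) (s_word j @ s_word i)"
| vv_comm: "1 \<le> i \<Longrightarrow> i < n \<Longrightarrow> 1 \<le> j \<Longrightarrow> j < n \<Longrightarrow> \<bar>int i - int j\<bar> > 1 \<Longrightarrow>
    vb_relation n (v_word i @ v_word j) (v_word j @ v_word i)"
| sv_comm: "1 \<le> i \<Longrightarrow> i < n \<Longrightarrow> 1 \<le> j \<Longrightarrow> j < n \<Longrightarrow> \<bar>int i - int j\<bar> > 1 \<Longrightarrow>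
    vb_relation n (s_word i @ v_word j) (v_word j @ s_word i)"
| vsv: "1 \<le> i \<Longrightarrow> i + 1 < n \<Longrightarrow>
    vb_relation n (v_word i @ s_word (i+1) @ v_word i) (v_word (i+1) @ s_word i @ v_word (i+1))"

inductive vb_step :: "nat \<Rightarrow> vb_word \<Rightarrow> vb_word \<Rightarrow> bool" for n :: nat where
  "vb_relation n l r \<Longrightarrow> u \<in> vb_words n \<Longrightarrow> w \<in> vb_words n \<Longrightarrow> vb_step n (u @ l @ w) (u @ r @ w)"

definition vb_eq :: "nat \<Rightarrow> (vb_word \<times> vb_word) set" where
  "vb_eq n = {(u, w). u \<in> vb_words n \<and> w \<in> vb_words n \<and> equivclp (vb_step n) u w}"

definition vb_class :: "nat \<Rightarrow> vb_word \<Rightarrow> vb_word set" where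
  "vb_class n w = vb_eq n `` {w}"

definition VB :: "nat \<Rightarrow> vb_word set monoid" where
  "VB n = \<lparr>carrier = vb_words n // vb_eq n,
           mult = (\<lambda>X Y. \<Union>x\<in>X. \<Union>y\<in>Y. vb_class n (x @ y)),
           one = vb_class n []\<rparr>"

definition sig :: "nat \<Rightarrow> nat \<Rightarrow> vb_word set" where
  "sig n i = vb_class n (s_word i)"

definition virt :: "nat \<Rightarrow> nat \<Rightarrow> vb_word set" where
  "virt n i = vb_class n (v_word i)"

text \<open>\<open>VB_right n\<close> and \<open>VB_left n\<close> map \<open>VB n\<close> to \<open>VB (n + 1)\<close>, adding an identity strand at
  the right, resp. at the left (the map \<open>b \<mapsto> i(b)\<close>).\<close>

definition VB_right :: "nat \<Rightarrow> vb_word set \<Rightarrow> vb_word set" where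
  "VB_right n X = (\<Union>w\<in>X. vb_class (n + 1) w)"

fun shift_gen :: "vb_gen \<Rightarrow> vb_gen" where
  "shift_gen (Sig i) = Sig (i + 1)"
| "shift_gen (Virt i) = Virt (i + 1)"

definition shift_word :: "vb_word \<Rightarrow> vb_word" where
  "shift_word = map (\<lambda>(x, e). (shift_gen x, e))"

definition VB_left :: "nat \<Rightarrow> vb_word set \<Rightarrow> vb_word set" where
  "VB_left n X = (\<Union>w\<in>X. vb_class (n + 1) (shift_word w))"

text \<open>Disjoint union: an element of \<open>VB\<^sub>n\<close> is tagged with its number \<open>n\<close> of strands.\<close>

definition VB_inf :: "(nat \<times> vb_word set) set" where
  "VB_inf = (SIGMA n:{1..}. carrier (VB n))"


section \<open>The two lists of moves\<close>

inductive kamada_move :: "nat \<times> vb_word set \<Rightarrow> nat \<times> vb_word set \<Rightarrow> bool" where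
  conjugation:
    "1 \<le> n \<Longrightarrow> b \<in> carrier (VB n) \<Longrightarrow> g \<in> carrier (VB n) \<Longrightarrow>
     kamada_move (n, b) (n, inv\<^bsub>VB n\<^esub> g \<otimes>\<^bsub>VB n\<^esub> b \<otimes>\<^bsub>VB n\<^esub> g)"
| right_stab_pos:
    "1 \<le> n \<Longrightarrow> b \<in> carrier (VB n) \<Longrightarrow>
     kamada_move (n, b) (n + 1, VB_right n b \<otimes>\<^bsub>VB (n + 1)\<^esub> sig (n + 1) n)"
| right_stab_neg:
    "1 \<le> n \<Longrightarrow> b \<in> carrier (VB n) \<Longrightarrow>
     kamada_move (n, b)
       (n + 1, VB_right n b \<otimes>\<^bsub>VB (n + 1)\<^esub> inv\<^bsub>VB (n + 1)\<^esub> sig (n + 1) n)"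
| right_stab_virt:
    "1 \<le> n \<Longrightarrow> b \<in> carrier (VB n) \<Longrightarrow>
     kamada_move (n, b) (n + 1, VB_right n b \<otimes>\<^bsub>VB (n + 1)\<^esub> virt (n + 1) n)"
| right_exchange:
    "1 \<le> n \<Longrightarrow> b1 \<in> carrier (VB n) \<Longrightarrow> b2 \<in> carrier (VB n) \<Longrightarrow>
     kamada_move
       (n + 1, VB_right n b1 \<otimes>\<^bsub>VB (n + 1)\<^esub> inv\<^bsub>VB (n + 1)\<^esub> sig (n + 1) n
                 \<otimes>\<^bsub>VB (n + 1)\<^esub> VB_right n b2 \<otimes>\<^bsub>VB (n + 1)\<^esub> sig (n + 1) n)
       (n + 1, VB_right n b1 \<otimes>\<^bsub>VB (n + 1)\<^esub> virt (n + 1) n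
                 \<otimes>\<^bsub>VB (n + 1)\<^esub> VB_right n b2 \<otimes>\<^bsub>VB (n + 1)\<^esub> virt (n + 1) n)"
| left_exchange:
    "1 \<le> n \<Longrightarrow> b1 \<in> carrier (VB n) \<Longrightarrow> b2 \<in> carrier (VB n) \<Longrightarrow>
     kamada_move
       (n + 1, VB_left n b1 \<otimes>\<^bsub>VB (n + 1)\<^esub> inv\<^bsub>VB (n + 1)\<^esub> sig (n + 1) 1
                 \<otimes>\<^bsub>VB (n + 1)\<^esub> VB_left n b2 \<otimes>\<^bsub>VB (n + 1)\<^esub> sig (n + 1) 1)
       (n + 1, VB_left n b1 \<otimes>\<^bsub>VB (n + 1)\<^esub> virt (n + 1) 1
                 \<otimes>\<^bsub>VB (n + 1)\<^esub> VB_left n b2 \<otimes>\<^bsub>VB (n + 1)\<^esub> virt (n + 1) 1)"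

text \<open>In the threading moves \<open>2 \<le> n\<close>, since \<open>v\<^sub>n\<^sub>-\<^sub>1\<close> has to be a generator.\<close>

inductive algebraic_move :: "nat \<times> vb_word set \<Rightarrow> nat \<times> vb_word set \<Rightarrow> bool" where
  virt_conj:
    "1 \<le> i \<Longrightarrow> i < n \<Longrightarrow> \<alpha> \<in> carrier (VB n) \<Longrightarrow>
     algebraic_move (n, virt n i \<otimes>\<^bsub>VB n\<^esub> \<alpha> \<otimes>\<^bsub>VB n\<^esub> virt n i) (n, \<alpha>)"
| real_conj:
    "1 \<le> i \<Longrightarrow> i < n \<Longrightarrow> \<alpha> \<in> carrier (VB n) \<Longrightarrow>
     algebraic_move (n, \<alpha>) (n, inv\<^bsub>VB n\<^esub> sig n i \<otimes>\<^bsub>VB n\<^esub> \<alpha> \<otimes>\<^bsub>VB n\<^esub> sig n i)"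
| virt_stab:
    "1 \<le> n \<Longrightarrow> \<alpha> \<in> carrier (VB n) \<Longrightarrow>
     algebraic_move (n + 1, VB_right n \<alpha> \<otimes>\<^bsub>VB (n + 1)\<^esub> virt (n + 1) n) (n, \<alpha>)"
| real_stab_pos:
    "1 \<le> n \<Longrightarrow> \<alpha> \<in> carrier (VB n) \<Longrightarrow>
     algebraic_move (n, \<alpha>) (n + 1, VB_right n \<alpha> \<otimes>\<^bsub>VB (n + 1)\<^esub> sig (n + 1) n)"
| real_stab_neg:
    "1 \<le> n \<Longrightarrow> \<alpha> \<in> carrier (VB n) \<Longrightarrow>
     algebraic_move (n, \<alpha>)
       (n + 1, VB_right n \<alpha> \<otimes>\<^bsub>VB (n + 1)\<^esub> inv\<^bsub>VB (n + 1)\<^esub> sig (n + 1) n)"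
| right_under_threading:
    "2 \<le> n \<Longrightarrow> \<alpha> \<in> carrier (VB n) \<Longrightarrow>
     algebraic_move (n, \<alpha>)
       (n + 1, VB_right n \<alpha> \<otimes>\<^bsub>VB (n + 1)\<^esub> inv\<^bsub>VB (n + 1)\<^esub> sig (n + 1) n
                 \<otimes>\<^bsub>VB (n + 1)\<^esub> virt (n + 1) (n - 1) \<otimes>\<^bsub>VB (n + 1)\<^esub> sig (n + 1) n)"
| left_under_threading:
    "2 \<le> n \<Longrightarrow> \<alpha> \<in> carrier (VB n) \<Longrightarrow>
     algebraic_move (n, \<alpha>)
       (n + 1, VB_right n \<alpha> \<otimes>\<^bsub>VB (n + 1)\<^esub> virt (n + 1) n
                 \<otimes>\<^bsub>VB (n + 1)\<^esub> virt (n + 1) (n - 1) \<otimes>\<^bsub>VB (n + 1)\<^esub> sig (n + 1) (n - 1)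
                 \<otimes>\<^bsub>VB (n + 1)\<^esub> virt (n + 1) n
                 \<otimes>\<^bsub>VB (n + 1)\<^esub> inv\<^bsub>VB (n + 1)\<^esub> sig (n + 1) (n - 1)
                 \<otimes>\<^bsub>VB (n + 1)\<^esub> virt (n + 1) (n - 1) \<otimes>\<^bsub>VB (n + 1)\<^esub> virt (n + 1) n)"


section \<open>Well-definedness\<close>

lemma vb_words_append [simp]: "u @ w \<in> vb_words n \<longleftrightarrow> u \<in> vb_words n \<and> w \<in> vb_words n"
  by (auto simp: vb_words_def)

lemma vb_words_Nil [simp]: "[] \<in> vb_words n"
  by (simp add: vb_words_def)

lemma vb_words_Cons [simp]:
  "(x, e) # w \<in> vb_words n \<longleftrightarrow> 1 \<le> gen_index x \<and> gen_index x < n \<and> w \<in> vb_words n"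
  by (auto simp: vb_words_def)

lemma vb_relation_words: "vb_relation n l r \<Longrightarrow> l \<in> vb_words n \<and> r \<in> vb_words n"
  by (induction rule: vb_relation.induct) auto

lemma equiv_vb_eq: "equiv (vb_words n) (vb_eq n)"
proof (rule equivI)
  show "vb_eq n \<subseteq> vb_words n \<times> vb_words n" "refl_on (vb_words n) (vb_eq n)"
    by (auto simp: vb_eq_def refl_on_def)
  show "sym (vb_eq n)" by (auto simp: vb_eq_def sym_def intro: equivclp_sym)
  show "trans (vb_eq n)" by (auto simp: vb_eq_def trans_def intro: equivclp_trans)
qed

lemma equivclp_map:
  assumes "equivclp R x y" and "\<And>a b. R a b \<Longrightarrow> equivclp S (f a) (f b)"
  shows "equivclp S (f x) (f y)"
  using assms(1)
proof (induction rule: equivclp_induct)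
  case base
  show ?case by simp
next
  case (step y z)
  then show ?case using assms(2) equivclp_sym equivclp_trans by metis
qed

lemma vb_step_append:
  assumes "vb_step n x y" "u \<in> vb_words n" "w \<in> vb_words n"
  shows "vb_step n (u @ x @ w) (u @ y @ w)"
  using assms(1)
proof cases
  case (1 l r u' w')
  then have "vb_step n ((u @ u') @ l @ (w' @ w)) ((u @ u') @ r @ (w' @ w))"
    using assms by (intro vb_step.intros) auto
  then show ?thesis using 1 by simp
qed

lemma vb_eq_append:
  assumes "(x, y) \<in> vb_eq n" "u \<in> vb_words n" "w \<in> vb_words n"
  shows "(u @ x @ w, u @ y @ w) \<in> vb_eq n"
proof -
  have "equivclp (vb_step n) (u @ x @ w) (u @ y @ w)"
    by (rule equivclp_map[where f = "\<lambda>z. u @ z @ w" and R = "vb_step n"])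
       (use assms in \<open>auto simp: vb_eq_def intro: vb_step_append\<close>)
  then show ?thesis using assms by (auto simp: vb_eq_def)
qed

lemma vb_class_eq_iff:
  "u \<in> vb_words n \<Longrightarrow> w \<in> vb_words n \<Longrightarrow> vb_class n u = vb_class n w \<longleftrightarrow> (u, w) \<in> vb_eq n"
  unfolding vb_class_def by (rule eq_equiv_class_iff[OF equiv_vb_eq])

lemma VB_carrierE:
  assumes "X \<in> carrier (VB n)"
  obtains w where "w \<in> vb_words n" "X = vb_class n w"
  using assms by (auto simp: VB_def vb_class_def elim: quotientE)

lemma vb_class_carrier [simp]: "w \<in> vb_words n \<Longrightarrow> vb_class n w \<in> carrier (VB n)"
  by (simp add: VB_def vb_class_def quotientI)

lemma one_VB: "\<one>\<^bsub>VB n\<^esub> = vb_class n []"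
  by (simp add: VB_def)

lemma mult_VB:
  assumes "u \<in> vb_words n" "w \<in> vb_words n"
  shows "vb_class n u \<otimes>\<^bsub>VB n\<^esub> vb_class n w = vb_class n (u @ w)"
proof -
  have "congruent2 (vb_eq n) (vb_eq n) (\<lambda>x y. vb_class n (x @ y))"
  proof (rule congruent2I[OF equiv_vb_eq equiv_vb_eq])
    fix y z w assume "w \<in> vb_words n" "(y, z) \<in> vb_eq n"
    then show "vb_class n (y @ w) = vb_class n (z @ w)"
      using vb_eq_append[of y z n "[]" w] by (subst vb_class_eq_iff) (auto simp: vb_eq_def)
  next
    fix y z w assume "w \<in> vb_words n" "(y, z) \<in> vb_eq n"
    then show "vb_class n (w @ y) = vb_class n (w @ z)"
      using vb_eq_append[of y z n w "[]"] by (subst vb_class_eq_iff) (auto simp: vb_eq_def)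
  qed
  from UN_equiv_class2[OF equiv_vb_eq equiv_vb_eq this assms] show ?thesis
    by (simp add: VB_def flip: vb_class_def)
qed

lemma vb_class_relation:
  assumes "vb_relation n l r"
  shows "vb_class n l = vb_class n r"
proof -
  have "vb_step n l r" using vb_step.intros[OF assms, of "[]" "[]"] by simp
  then show ?thesis
    using vb_relation_words[OF assms] by (subst vb_class_eq_iff) (auto simp: vb_eq_def)
qed

lemma vb_letter_inverse:
  assumes "1 \<le> gen_index x" "gen_index x < n"
  shows "vb_class n [(x, e), (x, \<not> e)] = \<one>\<^bsub>VB n\<^esub>"
  using assms by (cases e) (auto simp: one_VB intro!: vb_class_relation inv_left inv_right)

lemma vb_left_inverse:
  assumes "w \<in> vb_words n"
  shows "\<exists>u \<in> vb_words n. vb_class n (u @ w) = \<one>\<^bsub>VB n\<^esub>"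
  using assms
proof (induction w)
  case Nil
  then show ?case by (auto simp: one_VB intro: bexI[of _ "[]"])
next
  case (Cons a w)
  obtain x e where a: "a = (x, e)" by (cases a)
  with Cons obtain u where u: "u \<in> vb_words n" "vb_class n (u @ w) = \<one>\<^bsub>VB n\<^esub>" by auto
  have x: "1 \<le> gen_index x" "gen_index x < n" "w \<in> vb_words n" using Cons.prems a by auto
  have "vb_class n [(x, \<not> e), (x, e)] = vb_class n []"
    using vb_letter_inverse[OF x(1,2), of "\<not> e"] by (simp add: one_VB)
  then have "([(x, \<not> e), (x, e)], []) \<in> vb_eq n" using x by (subst (asm) vb_class_eq_iff) auto
  from vb_eq_append[OF this u(1) x(3)]
  have "vb_class n ((u @ [(x, \<not> e)]) @ a # w) = vb_class n (u @ w)"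
    using u x a by (subst vb_class_eq_iff) auto
  then show ?case using u x by (intro bexI[of _ "u @ [(x, \<not> e)]"]) auto
qed

lemma group_VB: "group (VB n)"
proof (rule groupI)
  fix X Y assume "X \<in> carrier (VB n)" "Y \<in> carrier (VB n)"
  then show "X \<otimes>\<^bsub>VB n\<^esub> Y \<in> carrier (VB n)" by (auto elim!: VB_carrierE simp: mult_VB)
next
  show "\<one>\<^bsub>VB n\<^esub> \<in> carrier (VB n)" by (simp add: one_VB)
next
  fix X Y Z assume "X \<in> carrier (VB n)" "Y \<in> carrier (VB n)" "Z \<in> carrier (VB n)"
  then show "X \<otimes>\<^bsub>VB n\<^esub> Y \<otimes>\<^bsub>VB n\<^esub> Z = X \<otimes>\<^bsub>VB n\<^esub> (Y \<otimes>\<^bsub>VB n\<^esub> Z)"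
    by (auto elim!: VB_carrierE simp: mult_VB)
next
  fix X assume "X \<in> carrier (VB n)"
  then show "\<one>\<^bsub>VB n\<^esub> \<otimes>\<^bsub>VB n\<^esub> X = X" by (auto elim!: VB_carrierE simp: mult_VB one_VB)
next
  fix X assume "X \<in> carrier (VB n)"
  then obtain w where w: "w \<in> vb_words n" "X = vb_class n w" by (rule VB_carrierE)
  then obtain u where "u \<in> vb_words n" "vb_class n (u @ w) = \<one>\<^bsub>VB n\<^esub>"
    using vb_left_inverse by blast
  with w show "\<exists>Y\<in>carrier (VB n). Y \<otimes>\<^bsub>VB n\<^esub> X = \<one>\<^bsub>VB n\<^esub>"
    by (intro bexI[of _ "vb_class n u"]) (auto simp: mult_VB)
qed

lemma vb_words_mono: "w \<in> vb_words n \<Longrightarrow> w \<in> vb_words (n + 1)"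
  by (auto simp: vb_words_def)

lemma vb_relation_mono: "vb_relation n l r \<Longrightarrow> vb_relation (n + 1) l r"
  by (induction rule: vb_relation.induct) (auto intro: vb_relation.intros[simplified])

lemma gen_index_shift [simp]: "gen_index (shift_gen x) = gen_index x + 1"
  by (cases x) auto

lemma shift_word_simps [simp]:
  "shift_word [] = []"
  "shift_word ((x, e) # w) = (shift_gen x, e) # shift_word w"
  "shift_word (u @ w) = shift_word u @ shift_word w"
  by (auto simp: shift_word_def)

lemma shift_word_words: "w \<in> vb_words n \<Longrightarrow> shift_word w \<in> vb_words (n + 1)"
  by (induction w) auto

lemma vb_relation_shift: "vb_relation n l r \<Longrightarrow> vb_relation (n + 1) (shift_word l) (shift_word r)"
proof (induction rule: vb_relation.induct)
  case (sss i)
  then show ?case using vb_relation.sss[of "i + 1" "n + 1"] by simp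
next
  case (vvv i)
  then show ?case using vb_relation.vvv[of "i + 1" "n + 1"] by simp
next
  case (vsv i)
  then show ?case using vb_relation.vsv[of "i + 1" "n + 1"] by simp
qed (auto intro!: vb_relation.intros[simplified])

lemma vb_step_right: "vb_step n x y \<Longrightarrow> vb_step (n + 1) x y"
proof (erule vb_step.cases)
  fix l r u w
  assume *: "vb_relation n l r" "u \<in> vb_words n" "w \<in> vb_words n" "x = u @ l @ w" "y = u @ r @ w"
  have "vb_step (n + 1) (u @ l @ w) (u @ r @ w)"
    using * by (intro vb_step.intros vb_relation_mono vb_words_mono)
  then show "vb_step (n + 1) x y" using * by simp
qed

lemma vb_eq_right:
  assumes "(x, y) \<in> vb_eq n"
  shows "(x, y) \<in> vb_eq (n + 1)"
proof -
  have "equivclp (vb_step (n + 1)) x y"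
    by (rule equivclp_map[where R = "vb_step n" and f = "\<lambda>z. z"])
       (use assms vb_step_right in \<open>auto simp: vb_eq_def\<close>)
  moreover have "x \<in> vb_words n" "y \<in> vb_words n" using assms by (auto simp: vb_eq_def)
  ultimately show ?thesis unfolding vb_eq_def by (blast intro: vb_words_mono)
qed

lemma VB_right_class:
  assumes "w \<in> vb_words n"
  shows "VB_right n (vb_class n w) = vb_class (n + 1) w"
proof -
  have "(\<lambda>w. vb_class (n + 1) w) respects vb_eq n"
    unfolding congruent_def vb_class_def
    using equiv_class_eq[OF equiv_vb_eq vb_eq_right] by blast
  from UN_equiv_class[OF equiv_vb_eq this assms] show ?thesis
    by (simp add: VB_right_def flip: vb_class_def)
qed

lemma vb_step_left: "vb_step n x y \<Longrightarrow> vb_step (n + 1) (shift_word x) (shift_word y)"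
proof (erule vb_step.cases)
  fix l r u w
  assume *: "vb_relation n l r" "u \<in> vb_words n" "w \<in> vb_words n" "x = u @ l @ w" "y = u @ r @ w"
  have "vb_step (n + 1) (shift_word u @ shift_word l @ shift_word w) (shift_word u @ shift_word r @ shift_word w)"
    using * by (intro vb_step.intros vb_relation_shift shift_word_words)
  then show "vb_step (n + 1) (shift_word x) (shift_word y)" using * by simp
qed

lemma vb_eq_left:
  assumes "(x, y) \<in> vb_eq n"
  shows "(shift_word x, shift_word y) \<in> vb_eq (n + 1)"
proof -
  have "equivclp (vb_step (n + 1)) (shift_word x) (shift_word y)"
    by (rule equivclp_map[where R = "vb_step n" and f = "shift_word"])
       (use assms vb_step_left in \<open>auto simp: vb_eq_def\<close>)
  moreover have "x \<in> vb_words n" "y \<in> vb_words n" using assms by (auto simp: vb_eq_def)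
  ultimately show ?thesis unfolding vb_eq_def by (blast intro: shift_word_words)
qed

lemma VB_left_class:
  assumes "w \<in> vb_words n"
  shows "VB_left n (vb_class n w) = vb_class (n + 1) (shift_word w)"
proof -
  have "(\<lambda>w. vb_class (n + 1) (shift_word w)) respects vb_eq n"
    unfolding congruent_def vb_class_def
    using equiv_class_eq[OF equiv_vb_eq vb_eq_left] by blast
  from UN_equiv_class[OF equiv_vb_eq this assms] show ?thesis
    by (simp add: VB_left_def flip: vb_class_def)
qed

lemma VB_right_hom: "VB_right n \<in> hom (VB n) (VB (n + 1))"
proof (rule homI)
  fix X assume "X \<in> carrier (VB n)"
  then show "VB_right n X \<in> carrier (VB (n + 1))"
    by (auto elim!: VB_carrierE simp: VB_right_class vb_words_mono[simplified])
next
  fix X Y assume "X \<in> carrier (VB n)" "Y \<in> carrier (VB n)"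
  then show "VB_right n (X \<otimes>\<^bsub>VB n\<^esub> Y) = VB_right n X \<otimes>\<^bsub>VB (n + 1)\<^esub> VB_right n Y"
    by (auto elim!: VB_carrierE simp: VB_right_class mult_VB vb_words_mono[simplified])
qed

lemma VB_left_hom: "VB_left n \<in> hom (VB n) (VB (n + 1))"
proof (rule homI)
  fix X assume "X \<in> carrier (VB n)"
  then show "VB_left n X \<in> carrier (VB (n + 1))"
    by (auto elim!: VB_carrierE simp: VB_left_class shift_word_words[simplified])
next
  fix X Y assume "X \<in> carrier (VB n)" "Y \<in> carrier (VB n)"
  then show "VB_left n (X \<otimes>\<^bsub>VB n\<^esub> Y) = VB_left n X \<otimes>\<^bsub>VB (n + 1)\<^esub> VB_left n Y"
    by (auto elim!: VB_carrierE simp: VB_left_class mult_VB shift_word_words[simplified])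
qed

lemma sig_closed: "1 \<le> i \<Longrightarrow> i < n \<Longrightarrow> sig n i \<in> carrier (VB n)"
  by (simp add: sig_def)

lemma virt_closed: "1 \<le> i \<Longrightarrow> i < n \<Longrightarrow> virt n i \<in> carrier (VB n)"
  by (simp add: virt_def)

lemmas VB_closed =
  group.is_monoid[OF group_VB, THEN monoid.m_closed] group.inv_closed[OF group_VB]
  sig_closed virt_closed hom_in_carrier[OF VB_right_hom] hom_in_carrier[OF VB_left_hom]

lemma kamada_move_VB_inf: "kamada_move x y \<Longrightarrow> x \<in> VB_inf \<and> y \<in> VB_inf"
  by (induction rule: kamada_move.induct)
     (auto simp: VB_inf_def intro!: VB_closed[simplified])

lemma algebraic_move_VB_inf: "algebraic_move x y \<Longrightarrow> x \<in> VB_inf \<and> y \<in> VB_inf"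
  by (induction rule: algebraic_move.induct)
     (auto simp: VB_inf_def intro!: VB_closed[simplified])

end

theory Submission
  imports Defs
begin

text \<open>
  The proof shows that exchange and threading are one move, up to conjugation and virtual
  stabilization. Let \<open>S\<^sub>n\<close> be \<open>\<sigma>\<^sub>n\<^sup>-\<^sup>1\<close> for the moves at the right, and \<open>v\<^sub>n\<sigma>\<^sub>nv\<^sub>n\<close> for those at the
  left. Then, for \<open>a\<close>, \<open>b\<close> in \<open>VB\<^sub>n\<close>, the two kinds of move can be written

    exchange: \<open>a S\<^sub>n b S\<^sub>n\<^sup>-\<^sup>1 \<sim> a v\<^sub>n b v\<^sub>n\<close>; threading: \<open>a \<sim> a S\<^sub>n v\<^sub>n\<^sub>-\<^sub>1 S\<^sub>n\<^sup>-\<^sup>1\<close>.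

  Exchange with \<open>b = v\<^sub>n\<^sub>-\<^sub>1\<close> turns the right-hand side of threading into
  \<open>a v\<^sub>nv\<^sub>n\<^sub>-\<^sub>1v\<^sub>n = a v\<^sub>n\<^sub>-\<^sub>1v\<^sub>nv\<^sub>n\<^sub>-\<^sub>1\<close>; conjugation leaves a single \<open>v\<^sub>n\<close> at the end, which virtual
  stabilization removes (\<open>exchange_imp_threading\<close>). Conversely, thread \<open>v\<^sub>n a v\<^sub>n b\<close> on \<open>n + 1\<close>
  strands. The new \<open>S\<^sub>n\<^sub>+\<^sub>1\<close> commutes with \<open>b\<close>, and \<open>v\<^sub>nS\<^sub>n\<^sub>+\<^sub>1v\<^sub>n = v\<^sub>n\<^sub>+\<^sub>1S\<^sub>nv\<^sub>n\<^sub>+\<^sub>1\<close> moves the crossings to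
  the strands \<open>n\<close>, \<open>n + 1\<close>; what is left of the new strand is a single \<open>v\<^sub>n\<^sub>+\<^sub>1\<close>, which is removed by
  virtual stabilization (\<open>threading_to_stabilization\<close>, \<open>threading_imp_exchange\<close>). So threading on
  \<open>n + 1\<close> strands gives exchange for \<open>VB\<^sub>n\<close>, and exchange gives threading for the same \<open>n\<close>. Of \<open>S\<^sub>n\<close>
  the argument uses the two relations just named, and so it serves both sides
  (\<open>threading_iff_exchange\<close>).

  At the right the moves have this form from the start. Left exchange gets it by conjugating with a
  product of virtual generators that moves strand \<open>1\<close> to place \<open>n + 1\<close>, strand \<open>2\<close> to place \<open>n\<close>,
  and every other strand two places to the left: it takes \<open>i(b)\<close> to a conjugate of \<open>b\<close> in
  \<open>VB\<^sub>n\<close>, \<open>v\<^sub>1\<close> to \<open>v\<^sub>n\<close> and \<open>\<sigma>\<^sub>1\<close> to \<open>v\<^sub>n\<sigma>\<^sub>nv\<^sub>n\<close> (\<open>left_exchange_iff\<close>). Left threading gets it by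
  a computation in the group and conjugation with \<open>v\<^sub>n\<^sub>-\<^sub>1\<close> (\<open>left_threading_iff\<close>).
\<close>

section \<open>Identities in groups\<close>

text \<open>
  The heart of the passage from threading to exchange. Here \<open>v\<close>, \<open>t\<close> are \<open>v\<^sub>n\<close>, \<open>v\<^sub>n\<^sub>+\<^sub>1\<close>, and \<open>S\<close>, \<open>T\<close> are
  \<open>S\<^sub>n\<close>, \<open>S\<^sub>n\<^sub>+\<^sub>1\<close>. The left side is a threaded braid up to conjugation. On the right, conjugating
  away the outer \<open>t\<close> leaves a product in which only one letter, \<open>t\<close>, involves the last strand.
\<close>

lemma (in group) threading_to_stabilization:
  assumes c: "a \<in> carrier G" "b \<in> carrier G" "v \<in> carrier G" "t \<in> carrier G" "S \<in> carrier G" "T \<in> carrier G"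
    and v: "v \<otimes> v = \<one>" and t: "t \<otimes> t = \<one>" and braid: "v \<otimes> t \<otimes> v = t \<otimes> v \<otimes> t"
    and mixed: "v \<otimes> T \<otimes> v = t \<otimes> S \<otimes> t"
    and comm: "t \<otimes> a = a \<otimes> t" "t \<otimes> b = b \<otimes> t" "T \<otimes> b = b \<otimes> T"
  shows "a \<otimes> v \<otimes> b \<otimes> T \<otimes> v \<otimes> inv T \<otimes> v = t \<otimes> (a \<otimes> S \<otimes> v \<otimes> t \<otimes> v \<otimes> b \<otimes> inv S) \<otimes> t"
proof -
  have inv_v: "inv v = v" and inv_t: "inv t = t"
    using c v t by (auto intro: inv_equality)
  have "v \<otimes> inv T \<otimes> v = inv (v \<otimes> T \<otimes> v)"
    using c by (simp add: inv_mult_group inv_v m_assoc)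
  then have mixed_inv: "v \<otimes> inv T \<otimes> v = t \<otimes> inv S \<otimes> t"
    using c by (simp add: mixed inv_mult_group inv_t m_assoc)
  have cancel: "v \<otimes> (v \<otimes> x) = x" "t \<otimes> (t \<otimes> x) = x" if "x \<in> carrier G" for x
    using that c v t by (simp_all flip: m_assoc)
  have "a \<otimes> v \<otimes> b \<otimes> T \<otimes> v \<otimes> inv T \<otimes> v = a \<otimes> v \<otimes> (b \<otimes> T) \<otimes> (v \<otimes> inv T \<otimes> v)"
    using c by (simp add: m_assoc)
  also have "\<dots> = a \<otimes> (v \<otimes> T \<otimes> v) \<otimes> v \<otimes> b \<otimes> (v \<otimes> inv T \<otimes> v)"
    using c by (simp add: m_assoc cancel flip: comm)
  also have "\<dots> = (a \<otimes> t) \<otimes> S \<otimes> t \<otimes> v \<otimes> (b \<otimes> t) \<otimes> inv S \<otimes> t"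
    unfolding mixed mixed_inv using c by (simp add: m_assoc)
  also have "\<dots> = t \<otimes> (a \<otimes> S \<otimes> (t \<otimes> v \<otimes> t) \<otimes> b \<otimes> inv S) \<otimes> t"
    unfolding comm[symmetric] using c by (simp add: m_assoc)
  also have "\<dots> = t \<otimes> (a \<otimes> S \<otimes> v \<otimes> t \<otimes> v \<otimes> b \<otimes> inv S) \<otimes> t"
    unfolding braid[symmetric] using c by (simp add: m_assoc)
  finally show ?thesis .
qed

lemma (in group) inv_intertwine:
  assumes "h \<in> carrier G" "x \<in> carrier G" "y \<in> carrier G" and eq: "h \<otimes> x = y \<otimes> h"
  shows "h \<otimes> inv x = inv y \<otimes> h"
proof -
  have "h \<otimes> inv x = inv y \<otimes> (y \<otimes> h) \<otimes> inv x" using assms(1-3) by (simp flip: m_assoc)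
  also have "\<dots> = inv y \<otimes> h" unfolding eq[symmetric] using assms(1-3) by (simp add: m_assoc)
  finally show ?thesis .
qed

text \<open>
  The word of the left threading move, with \<open>u = v\<^sub>n\<^sub>-\<^sub>1\<close>, \<open>v = v\<^sub>n\<close>, \<open>s = \<sigma>\<^sub>n\<^sub>-\<^sub>1\<close>, \<open>T = \<sigma>\<^sub>n\<close>. The
  mixed relation expresses \<open>s\<close> by \<open>T\<close>, and what remains is a computation with the
  involutions \<open>u\<close> and \<open>v\<close> and their braid relation.
\<close>

lemma (in group) left_threading_identity:
  assumes c: "u \<in> carrier G" "v \<in> carrier G" "s \<in> carrier G" "T \<in> carrier G"
    and u: "u \<otimes> u = \<one>" and v: "v \<otimes> v = \<one>" and braid: "u \<otimes> v \<otimes> u = v \<otimes> u \<otimes> v"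
    and mixed: "u \<otimes> T \<otimes> u = v \<otimes> s \<otimes> v"
  shows "v \<otimes> u \<otimes> s \<otimes> v \<otimes> inv s \<otimes> u \<otimes> v = u \<otimes> (v \<otimes> T \<otimes> v) \<otimes> u \<otimes> inv (v \<otimes> T \<otimes> v) \<otimes> u"
proof -
  have inv_u: "inv u = u" and inv_v: "inv v = v"
    using c u v by (auto intro: inv_equality)
  have cancel: "u \<otimes> (u \<otimes> x) = x" "v \<otimes> (v \<otimes> x) = x" if "x \<in> carrier G" for x
    using that c u v by (simp_all flip: m_assoc)
  have "s = v \<otimes> (v \<otimes> s \<otimes> v) \<otimes> v" using c v by (simp add: m_assoc cancel)
  then have s: "s = v \<otimes> u \<otimes> T \<otimes> u \<otimes> v" using c by (simp flip: mixed add: m_assoc)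
  then have inv_s: "inv s = v \<otimes> u \<otimes> inv T \<otimes> u \<otimes> v"
    using c by (simp add: inv_mult_group inv_u inv_v m_assoc)
  have "v \<otimes> u \<otimes> s \<otimes> v \<otimes> inv s \<otimes> u \<otimes> v
      = v \<otimes> (u \<otimes> v \<otimes> u) \<otimes> T \<otimes> (u \<otimes> v \<otimes> u) \<otimes> inv T \<otimes> (u \<otimes> v \<otimes> u) \<otimes> v"
    unfolding inv_s unfolding s using c by (simp add: m_assoc cancel)
  also have "\<dots> = u \<otimes> (v \<otimes> T \<otimes> v) \<otimes> u \<otimes> inv (v \<otimes> T \<otimes> v) \<otimes> u"
    unfolding braid using c v by (simp add: m_assoc cancel inv_mult_group inv_v)
  finally show ?thesis .
qed

section \<open>Generators and relations\<close>

lemma virt_virt: "1 \<le> i \<Longrightarrow> i < n \<Longrightarrow> virt n i \<otimes>\<^bsub>VB n\<^esub> virt n i = \<one>\<^bsub>VB n\<^esub>"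
  using vb_class_relation[OF vv, of i n] by (simp add: virt_def mult_VB one_VB)

lemma inv_virt: "1 \<le> i \<Longrightarrow> i < n \<Longrightarrow> inv\<^bsub>VB n\<^esub> virt n i = virt n i"
  by (intro group.inv_equality[OF group_VB] virt_virt virt_closed)

text \<open>
  Proofs about all of \<open>VB\<^sub>n\<close> go through this form of induction on generators, in which inverses
  are taken care of by the closure of a subgroup.
\<close>

lemma VB_generators:
  assumes H: "subgroup H (VB n)"
    and gen: "\<And>i. 1 \<le> i \<Longrightarrow> i < n \<Longrightarrow> sig n i \<in> H" "\<And>i. 1 \<le> i \<Longrightarrow> i < n \<Longrightarrow> virt n i \<in> H"
  shows "H = carrier (VB n)"
proof -
  have "vb_class n w \<in> H" if "w \<in> vb_words n" for w
    using that
  proof (induction w)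
    case Nil
    then show ?case using subgroup.one_closed[OF H] by (simp add: one_VB)
  next
    case (Cons a w)
    obtain x e where a: "a = (x, e)" by (cases a)
    have x: "1 \<le> gen_index x" "gen_index x < n" and w: "w \<in> vb_words n" using Cons.prems a by auto
    have pos: "vb_class n [(x, True)] \<in> H"
      using gen x by (cases x) (auto simp: sig_def virt_def)
    have "inv\<^bsub>VB n\<^esub> vb_class n [(x, True)] = vb_class n [(x, False)]"
      using vb_letter_inverse[of x n False] x
      by (intro group.inv_equality[OF group_VB]) (simp_all add: mult_VB)
    then have "vb_class n [a] \<in> H"
      using pos subgroup.m_inv_closed[OF H pos] a by (cases e) auto
    then have "vb_class n [a] \<otimes>\<^bsub>VB n\<^esub> vb_class n w \<in> H"
      using Cons.IH w by (intro subgroup.m_closed[OF H])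
    then show ?case using a x w by (simp add: mult_VB)
  qed
  then show ?thesis using subgroup.subset[OF H] by (auto elim!: VB_carrierE)
qed

text \<open>
  Two homomorphisms out of \<open>VB\<^sub>n\<close> that \<open>h\<close> intertwines on generators are intertwined by \<open>h\<close>
  everywhere, because the elements with this property form a subgroup. With equal homomorphisms
  this is a commutation statement, and otherwise a conjugation formula.
\<close>

lemma VB_intertwine:
  assumes G: "group G" and f: "f \<in> hom (VB n) G" and g: "g \<in> hom (VB n) G" and h: "h \<in> carrier G"
    and sig: "\<And>i. 1 \<le> i \<Longrightarrow> i < n \<Longrightarrow> h \<otimes>\<^bsub>G\<^esub> f (sig n i) = g (sig n i) \<otimes>\<^bsub>G\<^esub> h"
    and virt: "\<And>i. 1 \<le> i \<Longrightarrow> i < n \<Longrightarrow> h \<otimes>\<^bsub>G\<^esub> f (virt n i) = g (virt n i) \<otimes>\<^bsub>G\<^esub> h"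
    and b: "b \<in> carrier (VB n)"
  shows "h \<otimes>\<^bsub>G\<^esub> f b = g b \<otimes>\<^bsub>G\<^esub> h"
proof -
  interpret f: group_hom "VB n" G f using G f group_VB by (simp add: group_hom_def group_hom_axioms_def)
  interpret g: group_hom "VB n" G g using G g group_VB by (simp add: group_hom_def group_hom_axioms_def)
  let ?H = "{x \<in> carrier (VB n). h \<otimes>\<^bsub>G\<^esub> f x = g x \<otimes>\<^bsub>G\<^esub> h}"
  have "subgroup ?H (VB n)"
  proof (rule f.G.subgroupI)
    show "?H \<noteq> {}" using h by (auto intro!: exI[of _ "\<one>\<^bsub>VB n\<^esub>"])
  next
    fix x assume "x \<in> ?H"
    then show "inv\<^bsub>VB n\<^esub> x \<in> ?H"
      using h f.H.inv_intertwine by simp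
  next
    fix x y assume "x \<in> ?H" "y \<in> ?H"
    then have x: "x \<in> carrier (VB n)" "h \<otimes>\<^bsub>G\<^esub> f x = g x \<otimes>\<^bsub>G\<^esub> h"
      and y: "y \<in> carrier (VB n)" "h \<otimes>\<^bsub>G\<^esub> f y = g y \<otimes>\<^bsub>G\<^esub> h" by auto
    have "h \<otimes>\<^bsub>G\<^esub> f (x \<otimes>\<^bsub>VB n\<^esub> y) = (h \<otimes>\<^bsub>G\<^esub> f x) \<otimes>\<^bsub>G\<^esub> f y"
      using x(1) y(1) h by (simp add: f.H.m_assoc)
    also have "\<dots> = g x \<otimes>\<^bsub>G\<^esub> (h \<otimes>\<^bsub>G\<^esub> f y)"
      unfolding x(2) using x(1) y(1) h by (simp add: f.H.m_assoc)
    also have "\<dots> = g (x \<otimes>\<^bsub>VB n\<^esub> y) \<otimes>\<^bsub>G\<^esub> h"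
      unfolding y(2) using x(1) y(1) h by (simp add: f.H.m_assoc)
    finally show "x \<otimes>\<^bsub>VB n\<^esub> y \<in> ?H" using x(1) y(1) by simp
  qed auto
  from VB_generators[OF this] sig virt have "?H = carrier (VB n)"
    by (auto simp: sig_closed virt_closed)
  then show ?thesis using b by auto
qed

lemma VB_right_sig: "1 \<le> i \<Longrightarrow> i < n \<Longrightarrow> VB_right n (sig n i) = sig (n + 1) i"
  by (simp add: sig_def VB_right_class)

lemma VB_right_virt: "1 \<le> i \<Longrightarrow> i < n \<Longrightarrow> VB_right n (virt n i) = virt (n + 1) i"
  by (simp add: virt_def VB_right_class)

lemma VB_left_sig: "1 \<le> i \<Longrightarrow> i < n \<Longrightarrow> VB_left n (sig n i) = sig (n + 1) (i + 1)"
  by (simp add: sig_def VB_left_class)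

lemma VB_left_virt: "1 \<le> i \<Longrightarrow> i < n \<Longrightarrow> VB_left n (virt n i) = virt (n + 1) (i + 1)"
  by (simp add: virt_def VB_left_class)

lemma virt_braid:
  assumes "1 \<le> i" "i + 1 < n"
  shows "virt n i \<otimes>\<^bsub>VB n\<^esub> virt n (i + 1) \<otimes>\<^bsub>VB n\<^esub> virt n i
       = virt n (i + 1) \<otimes>\<^bsub>VB n\<^esub> virt n i \<otimes>\<^bsub>VB n\<^esub> virt n (i + 1)"
  using vb_class_relation[OF vvv[OF assms]] assms by (simp add: virt_def mult_VB)

lemma sig_virt_mixed:
  assumes "1 \<le> i" "i + 1 < n"
  shows "virt n i \<otimes>\<^bsub>VB n\<^esub> sig n (i + 1) \<otimes>\<^bsub>VB n\<^esub> virt n i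
       = virt n (i + 1) \<otimes>\<^bsub>VB n\<^esub> sig n i \<otimes>\<^bsub>VB n\<^esub> virt n (i + 1)"
  using vb_class_relation[OF vsv[OF assms]] assms by (simp add: virt_def sig_def mult_VB)

lemma far_commute:
  assumes "1 \<le> i" "i + 1 < j" "j < n"
  shows "virt n j \<otimes>\<^bsub>VB n\<^esub> virt n i = virt n i \<otimes>\<^bsub>VB n\<^esub> virt n j"
    and "virt n j \<otimes>\<^bsub>VB n\<^esub> sig n i = sig n i \<otimes>\<^bsub>VB n\<^esub> virt n j"
    and "sig n j \<otimes>\<^bsub>VB n\<^esub> virt n i = virt n i \<otimes>\<^bsub>VB n\<^esub> sig n j"
    and "sig n j \<otimes>\<^bsub>VB n\<^esub> sig n i = sig n i \<otimes>\<^bsub>VB n\<^esub> sig n j"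
  using assms vb_class_relation[OF vv_comm, of j n i] vb_class_relation[OF sv_comm, of i n j]
    vb_class_relation[OF sv_comm, of j n i] vb_class_relation[OF ss_comm, of j n i]
  by (simp_all add: virt_def sig_def mult_VB)

lemmas VB_right_hom_Suc = VB_right_hom[simplified]
lemmas VB_left_hom_Suc = VB_left_hom[simplified]

text \<open>
  The mixed relation and the braid relation for virtual generators have the same shape, so from here
  on a family \<open>g\<close> stands for either kind of generator.
\<close>

lemma gen_mixed:
  assumes "g \<in> {sig N, virt N}" "1 \<le> i" "Suc i < N"
  shows "virt N i \<otimes>\<^bsub>VB N\<^esub> g (Suc i) \<otimes>\<^bsub>VB N\<^esub> virt N i
       = virt N (Suc i) \<otimes>\<^bsub>VB N\<^esub> g i \<otimes>\<^bsub>VB N\<^esub> virt N (Suc i)"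
  using assms virt_braid[of i N] sig_virt_mixed[of i N] by auto

lemma gen_far:
  assumes "g \<in> {sig N, virt N}" "1 \<le> i" "i < N" "1 \<le> j" "j < N" "Suc i < j \<or> Suc j < i"
  shows "virt N j \<otimes>\<^bsub>VB N\<^esub> g i = g i \<otimes>\<^bsub>VB N\<^esub> virt N j"
  using assms far_commute[of i j N] far_commute[of j i N] by auto

lemma gen_closed: "g \<in> {sig N, virt N} \<Longrightarrow> 1 \<le> i \<Longrightarrow> i < N \<Longrightarrow> g i \<in> carrier (VB N)"
  by (auto simp: sig_closed virt_closed)

lemma commute_last:
  assumes b: "b \<in> carrier (VB n)" and g: "g \<in> {sig (Suc (Suc n)), virt (Suc (Suc n))}"
  shows "g (Suc n) \<otimes>\<^bsub>VB (Suc (Suc n))\<^esub> VB_right (Suc n) (VB_right n b)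
       = VB_right (Suc n) (VB_right n b) \<otimes>\<^bsub>VB (Suc (Suc n))\<^esub> g (Suc n)"
proof (rule VB_intertwine[OF group_VB _ _ _ _ _ b])
  show "(\<lambda>b. VB_right (Suc n) (VB_right n b)) \<in> hom (VB n) (VB (Suc (Suc n)))"
    "(\<lambda>b. VB_right (Suc n) (VB_right n b)) \<in> hom (VB n) (VB (Suc (Suc n)))"
    using hom_compose[OF VB_right_hom_Suc[of n] VB_right_hom_Suc[of "Suc n"]] by (simp_all add: comp_def)
  show "g (Suc n) \<in> carrier (VB (Suc (Suc n)))" using g by (auto intro: gen_closed)
qed (use g VB_right_sig[of _ n] VB_right_sig[of _ "Suc n"] VB_right_virt[of _ n] VB_right_virt[of _ "Suc n"]
   far_commute[of _ "Suc n" "Suc (Suc n)"] in auto)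

section \<open>Conjugation from the left to the right end\<close>

text \<open>
  The product \<open>v\<^sub>k v\<^sub>k\<^sub>-\<^sub>1 \<cdots> v\<^sub>1\<close> in \<open>VB\<^sub>N\<close>, which moves strand \<open>1\<close> past the next \<open>k\<close> strands
  when products are read from right to left.
\<close>

primrec virt_cycle :: "nat \<Rightarrow> nat \<Rightarrow> vb_word set" where
  "virt_cycle N 0 = \<one>\<^bsub>VB N\<^esub>"
| "virt_cycle N (Suc k) = virt N (Suc k) \<otimes>\<^bsub>VB N\<^esub> virt_cycle N k"

lemma virt_cycle_closed: "k < N \<Longrightarrow> virt_cycle N k \<in> carrier (VB N)"
proof (induction k)
  case (Suc k)
  interpret group "VB N" by (rule group_VB)
  show ?case using Suc by (simp add: virt_closed)
qed (simp add: one_VB)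

lemma VB_right_virt_cycle: "k < N \<Longrightarrow> VB_right N (virt_cycle N k) = virt_cycle (Suc N) k"
proof (induction k)
  case 0
  show ?case using hom_one[OF VB_right_hom_Suc group_VB group_VB] by simp
next
  case (Suc k)
  then show ?case
    using hom_mult[OF VB_right_hom_Suc] VB_right_virt[of "Suc k" N] by (simp add: virt_cycle_closed virt_closed)
qed

lemma virt_cycle_far:
  assumes g: "g \<in> {sig N, virt N}" and "Suc k < j" "j < N"
  shows "virt_cycle N k \<otimes>\<^bsub>VB N\<^esub> g j = g j \<otimes>\<^bsub>VB N\<^esub> virt_cycle N k"
  using assms(2)
proof (induction k)
  case 0
  interpret group "VB N" by (rule group_VB)
  show ?case using gen_closed[OF g, of j] assms 0 by simp
next
  case (Suc k)
  interpret group "VB N" by (rule group_VB)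
  have c: "g j \<in> carrier (VB N)" "virt_cycle N k \<in> carrier (VB N)" "virt N (Suc k) \<in> carrier (VB N)"
    using Suc assms(3) gen_closed[OF g, of j] by (auto intro: virt_cycle_closed virt_closed)
  have "virt_cycle N (Suc k) \<otimes>\<^bsub>VB N\<^esub> g j = virt N (Suc k) \<otimes>\<^bsub>VB N\<^esub> (g j \<otimes>\<^bsub>VB N\<^esub> virt_cycle N k)"
    using Suc c by (simp add: m_assoc)
  also have "\<dots> = (virt N (Suc k) \<otimes>\<^bsub>VB N\<^esub> g j) \<otimes>\<^bsub>VB N\<^esub> virt_cycle N k"
    using c by (simp add: m_assoc)
  also have "virt N (Suc k) \<otimes>\<^bsub>VB N\<^esub> g j = g j \<otimes>\<^bsub>VB N\<^esub> virt N (Suc k)"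
    using Suc.prems assms(3) by (intro gen_far[OF g]) auto
  finally show ?case using c by (simp add: m_assoc)
qed

text \<open>
  The relation of \<open>gen_mixed\<close>, solved for moving \<open>g\<close> through a product of two virtual generators.
\<close>

lemma gen_slide:
  assumes g: "g \<in> {sig N, virt N}" and i: "1 \<le> i" "Suc i < N"
  shows "virt N (Suc i) \<otimes>\<^bsub>VB N\<^esub> virt N i \<otimes>\<^bsub>VB N\<^esub> g (Suc i)
       = g i \<otimes>\<^bsub>VB N\<^esub> virt N (Suc i) \<otimes>\<^bsub>VB N\<^esub> virt N i"
    and "g (Suc i) \<otimes>\<^bsub>VB N\<^esub> virt N i \<otimes>\<^bsub>VB N\<^esub> virt N (Suc i)
       = virt N i \<otimes>\<^bsub>VB N\<^esub> virt N (Suc i) \<otimes>\<^bsub>VB N\<^esub> g i"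
proof -
  interpret group "VB N" by (rule group_VB)
  let ?u = "virt N i" and ?v = "virt N (Suc i)"
  have c: "g i \<in> carrier (VB N)" "g (Suc i) \<in> carrier (VB N)" "?u \<in> carrier (VB N)" "?v \<in> carrier (VB N)"
    using i gen_closed[OF g] by (auto intro: virt_closed)
  have inv: "?u \<otimes>\<^bsub>VB N\<^esub> ?u = \<one>\<^bsub>VB N\<^esub>" "?v \<otimes>\<^bsub>VB N\<^esub> ?v = \<one>\<^bsub>VB N\<^esub>"
    using i by (simp_all add: virt_virt)
  have cancel: "?u \<otimes>\<^bsub>VB N\<^esub> (?u \<otimes>\<^bsub>VB N\<^esub> x) = x" "?v \<otimes>\<^bsub>VB N\<^esub> (?v \<otimes>\<^bsub>VB N\<^esub> x) = x"
    if "x \<in> carrier (VB N)" for x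
    using that c inv by (simp_all flip: m_assoc)
  note mixed = gen_mixed[OF g i]
  have "?v \<otimes>\<^bsub>VB N\<^esub> ?u \<otimes>\<^bsub>VB N\<^esub> g (Suc i)
     = ?v \<otimes>\<^bsub>VB N\<^esub> (?u \<otimes>\<^bsub>VB N\<^esub> g (Suc i) \<otimes>\<^bsub>VB N\<^esub> ?u) \<otimes>\<^bsub>VB N\<^esub> ?u"
    using c inv by (simp add: m_assoc)
  also have "\<dots> = g i \<otimes>\<^bsub>VB N\<^esub> ?v \<otimes>\<^bsub>VB N\<^esub> ?u"
    unfolding mixed using c by (simp add: m_assoc cancel)
  finally show "?v \<otimes>\<^bsub>VB N\<^esub> ?u \<otimes>\<^bsub>VB N\<^esub> g (Suc i) = g i \<otimes>\<^bsub>VB N\<^esub> ?v \<otimes>\<^bsub>VB N\<^esub> ?u" .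
  have "g (Suc i) \<otimes>\<^bsub>VB N\<^esub> ?u \<otimes>\<^bsub>VB N\<^esub> ?v
     = ?u \<otimes>\<^bsub>VB N\<^esub> (?u \<otimes>\<^bsub>VB N\<^esub> g (Suc i) \<otimes>\<^bsub>VB N\<^esub> ?u) \<otimes>\<^bsub>VB N\<^esub> ?v"
    using c by (simp add: m_assoc cancel)
  also have "\<dots> = ?u \<otimes>\<^bsub>VB N\<^esub> ?v \<otimes>\<^bsub>VB N\<^esub> g i"
    unfolding mixed using c inv by (simp add: m_assoc)
  finally show "g (Suc i) \<otimes>\<^bsub>VB N\<^esub> ?u \<otimes>\<^bsub>VB N\<^esub> ?v = ?u \<otimes>\<^bsub>VB N\<^esub> ?v \<otimes>\<^bsub>VB N\<^esub> g i" .
qed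

text \<open>
  The cycle takes strand \<open>i + 1\<close> to place \<open>i\<close>, so conjugation with it undoes the shift of indices
  as long as strand \<open>1\<close> is not involved.
\<close>

lemma virt_cycle_shift:
  assumes g: "g \<in> {sig N, virt N}" and "1 \<le> i" "i < k" "k < N"
  shows "virt_cycle N k \<otimes>\<^bsub>VB N\<^esub> g (Suc i) = g i \<otimes>\<^bsub>VB N\<^esub> virt_cycle N k"
  using assms(3,4)
proof (induction k)
  case 0
  then show ?case by simp
next
  case (Suc k)
  interpret group "VB N" by (rule group_VB)
  have c: "g i \<in> carrier (VB N)" "g (Suc i) \<in> carrier (VB N)" "virt_cycle N k \<in> carrier (VB N)"
     "virt N (Suc k) \<in> carrier (VB N)"
    using Suc.prems assms(2) gen_closed[OF g] by (auto intro: virt_cycle_closed virt_closed)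
  show ?case
  proof (cases "i = k")
    case False
    have "virt_cycle N (Suc k) \<otimes>\<^bsub>VB N\<^esub> g (Suc i) = virt N (Suc k) \<otimes>\<^bsub>VB N\<^esub> (g i \<otimes>\<^bsub>VB N\<^esub> virt_cycle N k)"
      using Suc False c by (simp add: m_assoc)
    also have "\<dots> = (virt N (Suc k) \<otimes>\<^bsub>VB N\<^esub> g i) \<otimes>\<^bsub>VB N\<^esub> virt_cycle N k"
      using c by (simp add: m_assoc)
    also have "virt N (Suc k) \<otimes>\<^bsub>VB N\<^esub> g i = g i \<otimes>\<^bsub>VB N\<^esub> virt N (Suc k)"
      using Suc.prems assms(2) False by (intro gen_far[OF g]) auto
    finally show ?thesis using c by (simp add: m_assoc)
  next
    case True
    with assms(2) obtain m where k: "k = Suc m" by (cases k) auto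
    have c': "virt N k \<in> carrier (VB N)" "virt_cycle N m \<in> carrier (VB N)"
      using Suc.prems k by (auto intro: virt_cycle_closed virt_closed)
    have "virt_cycle N (Suc k) \<otimes>\<^bsub>VB N\<^esub> g (Suc i)
        = virt N (Suc k) \<otimes>\<^bsub>VB N\<^esub> virt N k \<otimes>\<^bsub>VB N\<^esub> (virt_cycle N m \<otimes>\<^bsub>VB N\<^esub> g (Suc k))"
      using c c' k True by (simp add: m_assoc)
    also have "virt_cycle N m \<otimes>\<^bsub>VB N\<^esub> g (Suc k) = g (Suc k) \<otimes>\<^bsub>VB N\<^esub> virt_cycle N m"
      using Suc.prems k by (intro virt_cycle_far[OF g]) auto
    also have "virt N (Suc k) \<otimes>\<^bsub>VB N\<^esub> virt N k \<otimes>\<^bsub>VB N\<^esub> (g (Suc k) \<otimes>\<^bsub>VB N\<^esub> virt_cycle N m)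
       = (virt N (Suc k) \<otimes>\<^bsub>VB N\<^esub> virt N k \<otimes>\<^bsub>VB N\<^esub> g (Suc k)) \<otimes>\<^bsub>VB N\<^esub> virt_cycle N m"
      using c c' True by (simp add: m_assoc)
    also have "\<dots> = g k \<otimes>\<^bsub>VB N\<^esub> virt N (Suc k) \<otimes>\<^bsub>VB N\<^esub> virt N k \<otimes>\<^bsub>VB N\<^esub> virt_cycle N m"
      using Suc.prems k by (subst gen_slide[OF g]) auto
    finally show ?thesis using c c' k True by (simp add: m_assoc)
  qed
qed

text \<open>
  The right factor moves strand \<open>1\<close> to place \<open>k + 2\<close> and strand \<open>2\<close> to the first place, and the
  left factor then moves strand \<open>2\<close> on to place \<open>k + 1\<close>. So \<open>g 1\<close> becomes a crossing at these two
  places with the roles of the strands interchanged, hence the virtual generators around \<open>g (Suc k)\<close>.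
\<close>

lemma virt_cycle_virt_cycle_first:
  assumes g: "g \<in> {sig N, virt N}" and "Suc k < N"
  shows "virt_cycle N k \<otimes>\<^bsub>VB N\<^esub> virt_cycle N (Suc k) \<otimes>\<^bsub>VB N\<^esub> g 1
       = virt N (Suc k) \<otimes>\<^bsub>VB N\<^esub> g (Suc k) \<otimes>\<^bsub>VB N\<^esub> virt N (Suc k) \<otimes>\<^bsub>VB N\<^esub> (virt_cycle N k \<otimes>\<^bsub>VB N\<^esub> virt_cycle N (Suc k))"
  using assms(2)
proof (induction k)
  case 0
  interpret group "VB N" by (rule group_VB)
  show ?case using 0 gen_closed[OF g, of 1] virt_closed[of 1 N] virt_virt[of 1 N] by (simp add: m_assoc)
next
  case (Suc k)
  interpret group "VB N" by (rule group_VB)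
  let ?u = "virt N (Suc k)" and ?v = "virt N (Suc (Suc k))" and ?h = "virt_cycle N k \<otimes>\<^bsub>VB N\<^esub> virt_cycle N (Suc k)"
  have c: "g 1 \<in> carrier (VB N)" "g (Suc k) \<in> carrier (VB N)" "g (Suc (Suc k)) \<in> carrier (VB N)"
     "virt_cycle N k \<in> carrier (VB N)" "?u \<in> carrier (VB N)" "?v \<in> carrier (VB N)"
    using Suc.prems gen_closed[OF g] by (auto intro: virt_cycle_closed virt_closed)
  then have h: "?h \<in> carrier (VB N)" by simp
  have "virt_cycle N (Suc k) \<otimes>\<^bsub>VB N\<^esub> virt_cycle N (Suc (Suc k))
      = ?u \<otimes>\<^bsub>VB N\<^esub> (virt_cycle N k \<otimes>\<^bsub>VB N\<^esub> ?v) \<otimes>\<^bsub>VB N\<^esub> virt_cycle N (Suc k)"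
    using c by (simp add: m_assoc)
  also have "virt_cycle N k \<otimes>\<^bsub>VB N\<^esub> ?v = ?v \<otimes>\<^bsub>VB N\<^esub> virt_cycle N k"
    using Suc.prems by (intro virt_cycle_far) auto
  finally have split: "virt_cycle N (Suc k) \<otimes>\<^bsub>VB N\<^esub> virt_cycle N (Suc (Suc k)) = ?u \<otimes>\<^bsub>VB N\<^esub> ?v \<otimes>\<^bsub>VB N\<^esub> ?h"
    using c by (simp add: m_assoc)
  have "?u \<otimes>\<^bsub>VB N\<^esub> ?v \<otimes>\<^bsub>VB N\<^esub> ?h \<otimes>\<^bsub>VB N\<^esub> g 1 = ?u \<otimes>\<^bsub>VB N\<^esub> ?v \<otimes>\<^bsub>VB N\<^esub> (?h \<otimes>\<^bsub>VB N\<^esub> g 1)"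
    using c h by (simp add: m_assoc del: virt_cycle.simps)
  also have "\<dots> = (?u \<otimes>\<^bsub>VB N\<^esub> ?v \<otimes>\<^bsub>VB N\<^esub> ?u) \<otimes>\<^bsub>VB N\<^esub> g (Suc k) \<otimes>\<^bsub>VB N\<^esub> ?u \<otimes>\<^bsub>VB N\<^esub> ?h"
    using Suc.IH Suc.prems c h by (simp add: m_assoc del: virt_cycle.simps)
  also have "?u \<otimes>\<^bsub>VB N\<^esub> ?v \<otimes>\<^bsub>VB N\<^esub> ?u = ?v \<otimes>\<^bsub>VB N\<^esub> ?u \<otimes>\<^bsub>VB N\<^esub> ?v"
    using Suc.prems by (intro gen_mixed) auto
  also have "?v \<otimes>\<^bsub>VB N\<^esub> ?u \<otimes>\<^bsub>VB N\<^esub> ?v \<otimes>\<^bsub>VB N\<^esub> g (Suc k) \<otimes>\<^bsub>VB N\<^esub> ?u \<otimes>\<^bsub>VB N\<^esub> ?h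
      = ?v \<otimes>\<^bsub>VB N\<^esub> (?u \<otimes>\<^bsub>VB N\<^esub> ?v \<otimes>\<^bsub>VB N\<^esub> g (Suc k)) \<otimes>\<^bsub>VB N\<^esub> ?u \<otimes>\<^bsub>VB N\<^esub> ?h"
    using c h by (simp add: m_assoc del: virt_cycle.simps)
  also have "?u \<otimes>\<^bsub>VB N\<^esub> ?v \<otimes>\<^bsub>VB N\<^esub> g (Suc k) = g (Suc (Suc k)) \<otimes>\<^bsub>VB N\<^esub> ?u \<otimes>\<^bsub>VB N\<^esub> ?v"
    using Suc.prems by (intro gen_slide(2)[OF g, symmetric]) auto
  also have "?v \<otimes>\<^bsub>VB N\<^esub> (g (Suc (Suc k)) \<otimes>\<^bsub>VB N\<^esub> ?u \<otimes>\<^bsub>VB N\<^esub> ?v) \<otimes>\<^bsub>VB N\<^esub> ?u \<otimes>\<^bsub>VB N\<^esub> ?h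
      = ?v \<otimes>\<^bsub>VB N\<^esub> g (Suc (Suc k)) \<otimes>\<^bsub>VB N\<^esub> (?u \<otimes>\<^bsub>VB N\<^esub> ?v \<otimes>\<^bsub>VB N\<^esub> ?u) \<otimes>\<^bsub>VB N\<^esub> ?h"
    using c h by (simp add: m_assoc del: virt_cycle.simps)
  also have "?u \<otimes>\<^bsub>VB N\<^esub> ?v \<otimes>\<^bsub>VB N\<^esub> ?u = ?v \<otimes>\<^bsub>VB N\<^esub> ?u \<otimes>\<^bsub>VB N\<^esub> ?v"
    using Suc.prems by (intro gen_mixed) auto
  finally show ?case unfolding split using c h by (simp add: m_assoc del: virt_cycle.simps)
qed

lemma VB_right_closed: "b \<in> carrier (VB n) \<Longrightarrow> VB_right n b \<in> carrier (VB (Suc n))"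
  by (rule hom_in_carrier[OF VB_right_hom_Suc])

lemma VB_left_closed: "b \<in> carrier (VB n) \<Longrightarrow> VB_left n b \<in> carrier (VB (Suc n))"
  by (rule hom_in_carrier[OF VB_left_hom_Suc])

lemma VB_right_mult:
  "a \<in> carrier (VB n) \<Longrightarrow> b \<in> carrier (VB n) \<Longrightarrow>
   VB_right n (a \<otimes>\<^bsub>VB n\<^esub> b) = VB_right n a \<otimes>\<^bsub>VB (Suc n)\<^esub> VB_right n b"
  by (rule hom_mult[OF VB_right_hom_Suc])

lemma VB_right_inv:
  "b \<in> carrier (VB n) \<Longrightarrow> VB_right n (inv\<^bsub>VB n\<^esub> b) = inv\<^bsub>VB (Suc n)\<^esub> VB_right n b"
  by (rule group_hom.hom_inv)
     (simp_all add: group_hom_def group_hom_axioms_def group_VB VB_right_hom_Suc)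

text \<open>
  Of the two cycles in \<open>h\<close>, the right factor turns \<open>i(b)\<close> into \<open>b\<close> on the first \<open>n\<close> strands. The
  left one lies in the right copy of \<open>VB\<^sub>n\<close> and so only conjugates \<open>b\<close> there; it is needed to take the first
  crossing to the last one.
\<close>

lemma VB_left_conj:
  fixes n defines "G \<equiv> VB (Suc n)" and "h \<equiv> virt_cycle (Suc n) (n - 1) \<otimes>\<^bsub>VB (Suc n)\<^esub> virt_cycle (Suc n) n"
  assumes n: "1 \<le> n" and b: "b \<in> carrier (VB n)"
  shows "h \<otimes>\<^bsub>G\<^esub> VB_left n b = VB_right n (virt_cycle n (n - 1) \<otimes>\<^bsub>VB n\<^esub> b \<otimes>\<^bsub>VB n\<^esub> inv\<^bsub>VB n\<^esub> virt_cycle n (n - 1)) \<otimes>\<^bsub>G\<^esub> h"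
proof -
  interpret H: group "VB n" by (rule group_VB)
  interpret group G unfolding G_def by (rule group_VB)
  let ?r = "virt_cycle (Suc n) (n - 1)" and ?t = "virt_cycle (Suc n) n"
  have c: "?r \<in> carrier G" "?t \<in> carrier G" "VB_right n b \<in> carrier G" "VB_left n b \<in> carrier G"
    using n b by (auto simp: G_def intro: virt_cycle_closed VB_right_closed VB_left_closed)
  have "?t \<otimes>\<^bsub>G\<^esub> VB_left n b = VB_right n b \<otimes>\<^bsub>G\<^esub> ?t"
  proof (rule VB_intertwine[OF is_group _ _ c(2) _ _ b])
    show "VB_left n \<in> hom (VB n) G" "VB_right n \<in> hom (VB n) G"
      unfolding G_def by (rule VB_left_hom_Suc VB_right_hom_Suc)+
    fix i assume i: "1 \<le> i" "i < n"
    show "?t \<otimes>\<^bsub>G\<^esub> VB_left n (sig n i) = VB_right n (sig n i) \<otimes>\<^bsub>G\<^esub> ?t"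
      unfolding G_def VB_left_sig[OF i] VB_right_sig[OF i] using virt_cycle_shift[of "sig (Suc n)" "Suc n" i n] i by simp
    show "?t \<otimes>\<^bsub>G\<^esub> VB_left n (virt n i) = VB_right n (virt n i) \<otimes>\<^bsub>G\<^esub> ?t"
      unfolding G_def VB_left_virt[OF i] VB_right_virt[OF i] using virt_cycle_shift[of "virt (Suc n)" "Suc n" i n] i by simp
  qed
  moreover have "VB_right n (virt_cycle n (n - 1) \<otimes>\<^bsub>VB n\<^esub> b \<otimes>\<^bsub>VB n\<^esub> inv\<^bsub>VB n\<^esub> virt_cycle n (n - 1))
      = ?r \<otimes>\<^bsub>G\<^esub> VB_right n b \<otimes>\<^bsub>G\<^esub> inv\<^bsub>G\<^esub> ?r"
    using n b virt_cycle_closed[of "n - 1" n] VB_right_virt_cycle[of "n - 1" n]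
    by (simp add: VB_right_mult VB_right_inv G_def)
  moreover have "inv\<^bsub>G\<^esub> ?r \<otimes>\<^bsub>G\<^esub> (?r \<otimes>\<^bsub>G\<^esub> ?t) = ?t"
    using c by (simp flip: m_assoc)
  ultimately show ?thesis using c by (simp add: h_def m_assoc flip: G_def)
qed

section \<open>Exchange and threading\<close>

text \<open>
  The crossing \<open>S\<close> is a parameter: \<open>\<sigma>\<^sub>n\<^sup>-\<^sup>1\<close> yields the moves at the right, \<open>left_crossing n\<close>
  those at the left.
\<close>

definition threading :: "(nat \<times> vb_word set \<Rightarrow> nat \<times> vb_word set \<Rightarrow> bool) \<Rightarrow> nat \<Rightarrow> vb_word set \<Rightarrow> bool"
  where "threading R n S \<longleftrightarrow> (\<forall>a\<in>carrier (VB n).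
    R (n, a) (Suc n, VB_right n a \<otimes>\<^bsub>VB (Suc n)\<^esub> S \<otimes>\<^bsub>VB (Suc n)\<^esub> virt (Suc n) (n - 1)
                       \<otimes>\<^bsub>VB (Suc n)\<^esub> inv\<^bsub>VB (Suc n)\<^esub> S))"

definition exchange :: "(nat \<times> vb_word set \<Rightarrow> nat \<times> vb_word set \<Rightarrow> bool) \<Rightarrow> nat \<Rightarrow> vb_word set \<Rightarrow> bool"
  where "exchange R n S \<longleftrightarrow> (\<forall>a\<in>carrier (VB n). \<forall>b\<in>carrier (VB n).
    R (Suc n, VB_right n a \<otimes>\<^bsub>VB (Suc n)\<^esub> S \<otimes>\<^bsub>VB (Suc n)\<^esub> VB_right n b
                \<otimes>\<^bsub>VB (Suc n)\<^esub> inv\<^bsub>VB (Suc n)\<^esub> S)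
      (Suc n, VB_right n a \<otimes>\<^bsub>VB (Suc n)\<^esub> virt (Suc n) n \<otimes>\<^bsub>VB (Suc n)\<^esub> VB_right n b
                \<otimes>\<^bsub>VB (Suc n)\<^esub> virt (Suc n) n))"

definition left_exchange :: "(nat \<times> vb_word set \<Rightarrow> nat \<times> vb_word set \<Rightarrow> bool) \<Rightarrow> nat \<Rightarrow> bool"
  where "left_exchange R n \<longleftrightarrow> (\<forall>a\<in>carrier (VB n). \<forall>b\<in>carrier (VB n).
    R (Suc n, VB_left n a \<otimes>\<^bsub>VB (Suc n)\<^esub> inv\<^bsub>VB (Suc n)\<^esub> sig (Suc n) 1 \<otimes>\<^bsub>VB (Suc n)\<^esub> VB_left n b
                \<otimes>\<^bsub>VB (Suc n)\<^esub> sig (Suc n) 1)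
      (Suc n, VB_left n a \<otimes>\<^bsub>VB (Suc n)\<^esub> virt (Suc n) 1 \<otimes>\<^bsub>VB (Suc n)\<^esub> VB_left n b
                \<otimes>\<^bsub>VB (Suc n)\<^esub> virt (Suc n) 1))"

definition left_threading :: "(nat \<times> vb_word set \<Rightarrow> nat \<times> vb_word set \<Rightarrow> bool) \<Rightarrow> nat \<Rightarrow> bool"
  where "left_threading R n \<longleftrightarrow> (\<forall>a\<in>carrier (VB n).
    R (n, a) (Suc n, VB_right n a \<otimes>\<^bsub>VB (Suc n)\<^esub> virt (Suc n) n \<otimes>\<^bsub>VB (Suc n)\<^esub> virt (Suc n) (n - 1)
                \<otimes>\<^bsub>VB (Suc n)\<^esub> sig (Suc n) (n - 1) \<otimes>\<^bsub>VB (Suc n)\<^esub> virt (Suc n) n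
                \<otimes>\<^bsub>VB (Suc n)\<^esub> inv\<^bsub>VB (Suc n)\<^esub> sig (Suc n) (n - 1)
                \<otimes>\<^bsub>VB (Suc n)\<^esub> virt (Suc n) (n - 1) \<otimes>\<^bsub>VB (Suc n)\<^esub> virt (Suc n) n))"

text \<open>
  The image of \<open>\<sigma>\<^sub>1\<close> under the conjugation that takes the left end of a braid to the right end.
\<close>

definition left_crossing :: "nat \<Rightarrow> vb_word set" where
  "left_crossing n = virt (Suc n) n \<otimes>\<^bsub>VB (Suc n)\<^esub> sig (Suc n) n \<otimes>\<^bsub>VB (Suc n)\<^esub> virt (Suc n) n"

lemma left_crossing_closed: "1 \<le> n \<Longrightarrow> left_crossing n \<in> carrier (VB (Suc n))"
  by (simp add: left_crossing_def virt_closed sig_closed VB_closed(1))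

text \<open>
  What the two lists of moves have in common. Everything about exchange and threading is derived
  for an arbitrary such relation, and then applied to the equivalences that the two lists generate.
\<close>

locale markov_relation =
  fixes R :: "nat \<times> vb_word set \<Rightarrow> nat \<times> vb_word set \<Rightarrow> bool" (infix \<open>\<sim>\<close> 50)
  assumes equivp: "equivp R"
    and conj: "1 \<le> n \<Longrightarrow> b \<in> carrier (VB n) \<Longrightarrow> g \<in> carrier (VB n) \<Longrightarrow>
      (n, b) \<sim> (n, inv\<^bsub>VB n\<^esub> g \<otimes>\<^bsub>VB n\<^esub> b \<otimes>\<^bsub>VB n\<^esub> g)"
    and virt_stab: "1 \<le> n \<Longrightarrow> b \<in> carrier (VB n) \<Longrightarrow>
      (n, b) \<sim> (Suc n, VB_right n b \<otimes>\<^bsub>VB (Suc n)\<^esub> virt (Suc n) n)"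
begin

lemma sym: "x \<sim> y \<Longrightarrow> y \<sim> x"
  using equivp by (rule equivp_symp)

lemma trans [trans]: "x \<sim> y \<Longrightarrow> y \<sim> z \<Longrightarrow> x \<sim> z"
  using equivp by (rule equivp_transp)

text \<open>
  Conjugation in the form in which it is used below: no inverse has to be computed.
\<close>

lemma intertwined:
  assumes "1 \<le> n" "h \<in> carrier (VB n)" "x \<in> carrier (VB n)" "y \<in> carrier (VB n)"
    and eq: "h \<otimes>\<^bsub>VB n\<^esub> x = y \<otimes>\<^bsub>VB n\<^esub> h"
  shows "(n, x) \<sim> (n, y)"
proof -
  interpret group "VB n" by (rule group_VB)
  have "x = inv\<^bsub>VB n\<^esub> h \<otimes>\<^bsub>VB n\<^esub> (h \<otimes>\<^bsub>VB n\<^esub> x)" using assms(2,3) by (simp flip: m_assoc)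
  then have "x = inv\<^bsub>VB n\<^esub> h \<otimes>\<^bsub>VB n\<^esub> y \<otimes>\<^bsub>VB n\<^esub> h"
    unfolding eq using assms(2,4) by (simp add: m_assoc)
  with conj[of n y h] assms sym show ?thesis by simp
qed

lemma cyclic:
  assumes "1 \<le> n" "a \<in> carrier (VB n)" "b \<in> carrier (VB n)"
  shows "(n, a \<otimes>\<^bsub>VB n\<^esub> b) \<sim> (n, b \<otimes>\<^bsub>VB n\<^esub> a)"
proof -
  interpret group "VB n" by (rule group_VB)
  show ?thesis using assms by (intro intertwined[of n b]) (simp_all add: m_assoc)
qed

text \<open>
  Threading is exchange with \<open>b = v\<^sub>n\<^sub>-\<^sub>1\<close>: by the braid relation the virtual side becomes
  \<open>a v\<^sub>n\<^sub>-\<^sub>1v\<^sub>nv\<^sub>n\<^sub>-\<^sub>1\<close>, which is conjugate to the virtual stabilization of \<open>v\<^sub>n\<^sub>-\<^sub>1 a v\<^sub>n\<^sub>-\<^sub>1\<close>,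
  a conjugate of \<open>a\<close>.
\<close>

lemma exchange_imp_threading:
  assumes n: "2 \<le> n" and S: "S \<in> carrier (VB (Suc n))" and ex: "exchange R n S"
  shows "threading R n S"
  unfolding threading_def
proof
  fix a assume a: "a \<in> carrier (VB n)"
  interpret H: group "VB n" by (rule group_VB)
  define G where "G = VB (Suc n)"
  interpret group G unfolding G_def by (rule group_VB)
  define u' u v where "u' = virt n (n - 1)" and "u = virt (Suc n) (n - 1)" and "v = virt (Suc n) n"
  have u': "u' \<in> carrier (VB n)" "VB_right n u' = u" "u' \<otimes>\<^bsub>VB n\<^esub> u' = \<one>\<^bsub>VB n\<^esub>"
    using n VB_right_virt[of "n - 1" n] by (simp_all add: u'_def u_def virt_closed virt_virt)
  have c: "VB_right n a \<in> carrier G" "u \<in> carrier G" "v \<in> carrier G"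
    using n a by (auto simp: G_def u_def v_def intro: virt_closed VB_right_closed)
  have braid: "v \<otimes>\<^bsub>G\<^esub> u \<otimes>\<^bsub>G\<^esub> v = u \<otimes>\<^bsub>G\<^esub> v \<otimes>\<^bsub>G\<^esub> u"
    using n virt_braid[of "n - 1" "Suc n"] by (simp add: G_def u_def v_def)
  have "(n, a) \<sim> (n, u' \<otimes>\<^bsub>VB n\<^esub> (a \<otimes>\<^bsub>VB n\<^esub> u'))"
    using n a u' by (intro intertwined[of n u']) (simp_all add: H.m_assoc)
  also have "\<dots> \<sim> (Suc n, VB_right n (u' \<otimes>\<^bsub>VB n\<^esub> (a \<otimes>\<^bsub>VB n\<^esub> u')) \<otimes>\<^bsub>G\<^esub> v)"
    unfolding G_def v_def using n a u' by (intro virt_stab) auto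
  also have "VB_right n (u' \<otimes>\<^bsub>VB n\<^esub> (a \<otimes>\<^bsub>VB n\<^esub> u')) \<otimes>\<^bsub>G\<^esub> v
      = u \<otimes>\<^bsub>G\<^esub> (VB_right n a \<otimes>\<^bsub>G\<^esub> u \<otimes>\<^bsub>G\<^esub> v)"
    using a u' c by (simp add: VB_right_mult m_assoc flip: G_def)
  also have "(Suc n, \<dots>) \<sim> (Suc n, VB_right n a \<otimes>\<^bsub>G\<^esub> u \<otimes>\<^bsub>G\<^esub> v \<otimes>\<^bsub>G\<^esub> u)"
    unfolding G_def by (rule cyclic) (use c in \<open>auto simp flip: G_def\<close>)
  also have "VB_right n a \<otimes>\<^bsub>G\<^esub> u \<otimes>\<^bsub>G\<^esub> v \<otimes>\<^bsub>G\<^esub> u = VB_right n a \<otimes>\<^bsub>G\<^esub> (v \<otimes>\<^bsub>G\<^esub> u \<otimes>\<^bsub>G\<^esub> v)"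
    unfolding braid using c by (simp add: m_assoc)
  also have "\<dots> = VB_right n a \<otimes>\<^bsub>G\<^esub> v \<otimes>\<^bsub>G\<^esub> u \<otimes>\<^bsub>G\<^esub> v"
    using c by (simp add: m_assoc)
  also have "(Suc n, \<dots>) \<sim> (Suc n, VB_right n a \<otimes>\<^bsub>G\<^esub> S \<otimes>\<^bsub>G\<^esub> u \<otimes>\<^bsub>G\<^esub> inv\<^bsub>G\<^esub> S)"
    using ex a u' by (auto simp: exchange_def G_def v_def intro: sym)
  finally show "(n, a) \<sim> (Suc n, VB_right n a \<otimes>\<^bsub>VB (Suc n)\<^esub> S \<otimes>\<^bsub>VB (Suc n)\<^esub> virt (Suc n) (n - 1)
                       \<otimes>\<^bsub>VB (Suc n)\<^esub> inv\<^bsub>VB (Suc n)\<^esub> S)"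
    by (simp add: G_def u_def)
qed

text \<open>
  Both sides of an exchange move are braids on \<open>n + 1\<close> strands; the way from one to the other uses an
  auxiliary strand. It is added by threading, and once the crossings \<open>T\<close> have become crossings \<open>S\<close>
  it is attached by a single \<open>v\<^sub>n\<^sub>+\<^sub>1\<close> only.
\<close>

lemma threading_imp_exchange:
  assumes n: "1 \<le> n" and S: "S \<in> carrier (VB (Suc n))" and T: "T \<in> carrier (VB (Suc (Suc n)))"
    and mixed: "virt (Suc (Suc n)) n \<otimes>\<^bsub>VB (Suc (Suc n))\<^esub> T
          \<otimes>\<^bsub>VB (Suc (Suc n))\<^esub> virt (Suc (Suc n)) n
      = virt (Suc (Suc n)) (Suc n) \<otimes>\<^bsub>VB (Suc (Suc n))\<^esub> VB_right (Suc n) S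
          \<otimes>\<^bsub>VB (Suc (Suc n))\<^esub> virt (Suc (Suc n)) (Suc n)"
    and comm: "\<And>b. b \<in> carrier (VB n) \<Longrightarrow> T \<otimes>\<^bsub>VB (Suc (Suc n))\<^esub> VB_right (Suc n) (VB_right n b)
       = VB_right (Suc n) (VB_right n b) \<otimes>\<^bsub>VB (Suc (Suc n))\<^esub> T"
    and thr: "threading R (Suc n) T"
  shows "exchange R n S"
  unfolding exchange_def
proof (intro ballI)
  fix a' b' assume a': "a' \<in> carrier (VB n)" and b': "b' \<in> carrier (VB n)"
  define H where "H = VB (Suc n)"
  define G where "G = VB (Suc (Suc n))"
  interpret H: group H unfolding H_def by (rule group_VB)
  interpret group G unfolding G_def by (rule group_VB)
  let ?r = "VB_right (Suc n)"
  define a b w where "a = VB_right n a'" and "b = VB_right n b'" and "w = virt (Suc n) n"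
  define v t where "v = virt (Suc (Suc n)) n" and "t = virt (Suc (Suc n)) (Suc n)"
  have cH: "a \<in> carrier H" "b \<in> carrier H" "w \<in> carrier H" "S \<in> carrier H"
    using n a' b' S by (auto simp: H_def a_def b_def w_def intro: virt_closed VB_right_closed)
  have cG: "v \<in> carrier G" "t \<in> carrier G" "T \<in> carrier G"
    using n T by (auto simp: G_def v_def t_def intro: virt_closed)
  have r: "?r x \<in> carrier G" "?r (inv\<^bsub>H\<^esub> x) = inv\<^bsub>G\<^esub> ?r x" if "x \<in> carrier H" for x
    using that by (simp_all add: H_def G_def VB_right_closed VB_right_inv)
  have rm: "?r (x \<otimes>\<^bsub>H\<^esub> y) = ?r x \<otimes>\<^bsub>G\<^esub> ?r y" if "x \<in> carrier H" "y \<in> carrier H" for x y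
    using that by (simp add: H_def G_def VB_right_mult)
  have rw: "?r w = v" using n VB_right_virt[of n "Suc n"] by (simp add: w_def v_def)
  have "w \<otimes>\<^bsub>H\<^esub> w = \<one>\<^bsub>H\<^esub>" using n by (simp add: w_def H_def virt_virt)
  then have ww: "w \<otimes>\<^bsub>H\<^esub> (w \<otimes>\<^bsub>H\<^esub> x) = x" if "x \<in> carrier H" for x
    using that cH by (simp flip: H.m_assoc)
  have id: "?r a \<otimes>\<^bsub>G\<^esub> v \<otimes>\<^bsub>G\<^esub> ?r b \<otimes>\<^bsub>G\<^esub> T \<otimes>\<^bsub>G\<^esub> v \<otimes>\<^bsub>G\<^esub> inv\<^bsub>G\<^esub> T \<otimes>\<^bsub>G\<^esub> v
     = t \<otimes>\<^bsub>G\<^esub> (?r a \<otimes>\<^bsub>G\<^esub> ?r S \<otimes>\<^bsub>G\<^esub> v \<otimes>\<^bsub>G\<^esub> t \<otimes>\<^bsub>G\<^esub> v \<otimes>\<^bsub>G\<^esub> ?r b \<otimes>\<^bsub>G\<^esub> inv\<^bsub>G\<^esub> ?r S) \<otimes>\<^bsub>G\<^esub> t"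
  proof (rule threading_to_stabilization)
    show "v \<otimes>\<^bsub>G\<^esub> v = \<one>\<^bsub>G\<^esub>" "t \<otimes>\<^bsub>G\<^esub> t = \<one>\<^bsub>G\<^esub>"
      using n by (simp_all add: v_def t_def G_def virt_virt)
    show "v \<otimes>\<^bsub>G\<^esub> t \<otimes>\<^bsub>G\<^esub> v = t \<otimes>\<^bsub>G\<^esub> v \<otimes>\<^bsub>G\<^esub> t"
      using n virt_braid[of n "Suc (Suc n)"] by (simp add: v_def t_def G_def)
    show "v \<otimes>\<^bsub>G\<^esub> T \<otimes>\<^bsub>G\<^esub> v = t \<otimes>\<^bsub>G\<^esub> ?r S \<otimes>\<^bsub>G\<^esub> t"
      unfolding v_def t_def G_def by (rule mixed)
    show "t \<otimes>\<^bsub>G\<^esub> ?r a = ?r a \<otimes>\<^bsub>G\<^esub> t" "t \<otimes>\<^bsub>G\<^esub> ?r b = ?r b \<otimes>\<^bsub>G\<^esub> t" "T \<otimes>\<^bsub>G\<^esub> ?r b = ?r b \<otimes>\<^bsub>G\<^esub> T"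
      using commute_last[OF a', of "virt (Suc (Suc n))"] commute_last[OF b', of "virt (Suc (Suc n))"] comm[OF b']
      by (simp_all add: a_def b_def t_def G_def)
  qed (use cH cG r in auto)
  let ?c = "w \<otimes>\<^bsub>H\<^esub> (b \<otimes>\<^bsub>H\<^esub> inv\<^bsub>H\<^esub> S \<otimes>\<^bsub>H\<^esub> a \<otimes>\<^bsub>H\<^esub> S \<otimes>\<^bsub>H\<^esub> w)"
  \<comment> \<open>The rotation makes \<open>b\<close> the last factor, where it can pass the new crossing \<open>T\<close>.\<close>
  have "(Suc n, a \<otimes>\<^bsub>H\<^esub> w \<otimes>\<^bsub>H\<^esub> b \<otimes>\<^bsub>H\<^esub> w) \<sim> (Suc n, w \<otimes>\<^bsub>H\<^esub> (a \<otimes>\<^bsub>H\<^esub> w \<otimes>\<^bsub>H\<^esub> b))"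
    unfolding H_def by (rule cyclic) (use cH in \<open>auto simp flip: H_def\<close>)
  also have "\<dots> \<sim> (Suc (Suc n), ?r (w \<otimes>\<^bsub>H\<^esub> (a \<otimes>\<^bsub>H\<^esub> w \<otimes>\<^bsub>H\<^esub> b)) \<otimes>\<^bsub>G\<^esub> T \<otimes>\<^bsub>G\<^esub> v \<otimes>\<^bsub>G\<^esub> inv\<^bsub>G\<^esub> T)"
    using thr cH by (simp add: threading_def G_def v_def flip: H_def)
  also have "?r (w \<otimes>\<^bsub>H\<^esub> (a \<otimes>\<^bsub>H\<^esub> w \<otimes>\<^bsub>H\<^esub> b)) \<otimes>\<^bsub>G\<^esub> T \<otimes>\<^bsub>G\<^esub> v \<otimes>\<^bsub>G\<^esub> inv\<^bsub>G\<^esub> T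
      = v \<otimes>\<^bsub>G\<^esub> (?r a \<otimes>\<^bsub>G\<^esub> v \<otimes>\<^bsub>G\<^esub> ?r b \<otimes>\<^bsub>G\<^esub> T \<otimes>\<^bsub>G\<^esub> v \<otimes>\<^bsub>G\<^esub> inv\<^bsub>G\<^esub> T)"
    using cH cG by (simp add: rm rw r m_assoc)
  also have "(Suc (Suc n), \<dots>) \<sim> (Suc (Suc n), ?r a \<otimes>\<^bsub>G\<^esub> v \<otimes>\<^bsub>G\<^esub> ?r b \<otimes>\<^bsub>G\<^esub> T \<otimes>\<^bsub>G\<^esub> v \<otimes>\<^bsub>G\<^esub> inv\<^bsub>G\<^esub> T \<otimes>\<^bsub>G\<^esub> v)"
    unfolding G_def by (rule cyclic) (use cH cG r in \<open>auto simp flip: G_def\<close>)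
  also note id
  also have "(Suc (Suc n), t \<otimes>\<^bsub>G\<^esub> (?r a \<otimes>\<^bsub>G\<^esub> ?r S \<otimes>\<^bsub>G\<^esub> v \<otimes>\<^bsub>G\<^esub> t \<otimes>\<^bsub>G\<^esub> v \<otimes>\<^bsub>G\<^esub> ?r b \<otimes>\<^bsub>G\<^esub> inv\<^bsub>G\<^esub> ?r S) \<otimes>\<^bsub>G\<^esub> t)
     \<sim> (Suc (Suc n), t \<otimes>\<^bsub>G\<^esub> (t \<otimes>\<^bsub>G\<^esub> (?r a \<otimes>\<^bsub>G\<^esub> ?r S \<otimes>\<^bsub>G\<^esub> v \<otimes>\<^bsub>G\<^esub> t \<otimes>\<^bsub>G\<^esub> v \<otimes>\<^bsub>G\<^esub> ?r b \<otimes>\<^bsub>G\<^esub> inv\<^bsub>G\<^esub> ?r S)))"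
    unfolding G_def by (rule cyclic) (use cH cG r in \<open>auto simp flip: G_def\<close>)
  also have "t \<otimes>\<^bsub>G\<^esub> (t \<otimes>\<^bsub>G\<^esub> (?r a \<otimes>\<^bsub>G\<^esub> ?r S \<otimes>\<^bsub>G\<^esub> v \<otimes>\<^bsub>G\<^esub> t \<otimes>\<^bsub>G\<^esub> v \<otimes>\<^bsub>G\<^esub> ?r b \<otimes>\<^bsub>G\<^esub> inv\<^bsub>G\<^esub> ?r S))
     = (?r a \<otimes>\<^bsub>G\<^esub> ?r S \<otimes>\<^bsub>G\<^esub> v \<otimes>\<^bsub>G\<^esub> t) \<otimes>\<^bsub>G\<^esub> (v \<otimes>\<^bsub>G\<^esub> ?r b \<otimes>\<^bsub>G\<^esub> inv\<^bsub>G\<^esub> ?r S)"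
    (is "?x = _")
  proof -
    have "t \<otimes>\<^bsub>G\<^esub> t = \<one>\<^bsub>G\<^esub>" by (simp add: t_def G_def virt_virt)
    then have "t \<otimes>\<^bsub>G\<^esub> (t \<otimes>\<^bsub>G\<^esub> x) = x" if "x \<in> carrier G" for x
      using that cG by (simp flip: m_assoc)
    then show ?thesis using cH cG r by (simp add: m_assoc)
  qed
  also have "(Suc (Suc n), \<dots>) \<sim>
     (Suc (Suc n), (v \<otimes>\<^bsub>G\<^esub> ?r b \<otimes>\<^bsub>G\<^esub> inv\<^bsub>G\<^esub> ?r S) \<otimes>\<^bsub>G\<^esub> (?r a \<otimes>\<^bsub>G\<^esub> ?r S \<otimes>\<^bsub>G\<^esub> v \<otimes>\<^bsub>G\<^esub> t))"
    unfolding G_def by (rule cyclic) (use cH cG r in \<open>auto simp flip: G_def\<close>)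
  also have "(v \<otimes>\<^bsub>G\<^esub> ?r b \<otimes>\<^bsub>G\<^esub> inv\<^bsub>G\<^esub> ?r S) \<otimes>\<^bsub>G\<^esub> (?r a \<otimes>\<^bsub>G\<^esub> ?r S \<otimes>\<^bsub>G\<^esub> v \<otimes>\<^bsub>G\<^esub> t) = ?r ?c \<otimes>\<^bsub>G\<^esub> t"
    using cH cG by (simp add: rm rw r m_assoc)
  also have "(Suc (Suc n), \<dots>) \<sim> (Suc n, ?c)"
    unfolding G_def t_def by (rule sym, rule virt_stab) (use cH in \<open>auto simp flip: H_def\<close>)
  also have "?c = (w \<otimes>\<^bsub>H\<^esub> b \<otimes>\<^bsub>H\<^esub> inv\<^bsub>H\<^esub> S) \<otimes>\<^bsub>H\<^esub> (a \<otimes>\<^bsub>H\<^esub> S \<otimes>\<^bsub>H\<^esub> w)"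
    using cH by (simp add: H.m_assoc)
  also have "(Suc n, \<dots>) \<sim> (Suc n, (a \<otimes>\<^bsub>H\<^esub> S \<otimes>\<^bsub>H\<^esub> w) \<otimes>\<^bsub>H\<^esub> (w \<otimes>\<^bsub>H\<^esub> b \<otimes>\<^bsub>H\<^esub> inv\<^bsub>H\<^esub> S))"
    unfolding H_def by (rule cyclic) (use cH in \<open>auto simp flip: H_def\<close>)
  also have "(a \<otimes>\<^bsub>H\<^esub> S \<otimes>\<^bsub>H\<^esub> w) \<otimes>\<^bsub>H\<^esub> (w \<otimes>\<^bsub>H\<^esub> b \<otimes>\<^bsub>H\<^esub> inv\<^bsub>H\<^esub> S) = a \<otimes>\<^bsub>H\<^esub> S \<otimes>\<^bsub>H\<^esub> b \<otimes>\<^bsub>H\<^esub> inv\<^bsub>H\<^esub> S"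
    using cH by (simp add: H.m_assoc ww)
  finally show "(Suc n, VB_right n a' \<otimes>\<^bsub>VB (Suc n)\<^esub> S \<otimes>\<^bsub>VB (Suc n)\<^esub> VB_right n b'
                \<otimes>\<^bsub>VB (Suc n)\<^esub> inv\<^bsub>VB (Suc n)\<^esub> S)
      \<sim> (Suc n, VB_right n a' \<otimes>\<^bsub>VB (Suc n)\<^esub> virt (Suc n) n \<otimes>\<^bsub>VB (Suc n)\<^esub> VB_right n b'
                \<otimes>\<^bsub>VB (Suc n)\<^esub> virt (Suc n) n)"
    unfolding a_def b_def w_def H_def by (rule sym)
qed

text \<open>
  The equivalence is between the moves for all \<open>n\<close> together, as threading has to be available on one
  more strand than exchange.
\<close>

lemma threading_iff_exchange:
  assumes S: "\<And>n. 1 \<le> n \<Longrightarrow> S n \<in> carrier (VB (Suc n))"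
    and mixed: "\<And>n. 1 \<le> n \<Longrightarrow> virt (Suc (Suc n)) n \<otimes>\<^bsub>VB (Suc (Suc n))\<^esub> S (Suc n)
          \<otimes>\<^bsub>VB (Suc (Suc n))\<^esub> virt (Suc (Suc n)) n
      = virt (Suc (Suc n)) (Suc n) \<otimes>\<^bsub>VB (Suc (Suc n))\<^esub> VB_right (Suc n) (S n)
          \<otimes>\<^bsub>VB (Suc (Suc n))\<^esub> virt (Suc (Suc n)) (Suc n)"
    and comm: "\<And>n b. 1 \<le> n \<Longrightarrow> b \<in> carrier (VB n) \<Longrightarrow> S (Suc n) \<otimes>\<^bsub>VB (Suc (Suc n))\<^esub> VB_right (Suc n) (VB_right n b)
       = VB_right (Suc n) (VB_right n b) \<otimes>\<^bsub>VB (Suc (Suc n))\<^esub> S (Suc n)"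
  shows "(\<forall>n\<ge>2. threading R n (S n)) \<longleftrightarrow> (\<forall>n\<ge>1. exchange R n (S n))"
proof (intro iffI allI impI)
  fix n :: nat assume "\<forall>n\<ge>2. threading R n (S n)" "1 \<le> n"
  then show "exchange R n (S n)"
    by (intro threading_imp_exchange[OF _ S S mixed comm]) auto
next
  fix n :: nat assume "\<forall>n\<ge>1. exchange R n (S n)" "2 \<le> n"
  then show "threading R n (S n)"
    by (intro exchange_imp_threading S) auto
qed

lemma right_threading_iff_exchange:
  "(\<forall>n\<ge>2. threading R n (inv\<^bsub>VB (Suc n)\<^esub> sig (Suc n) n)) \<longleftrightarrow>
   (\<forall>n\<ge>1. exchange R n (inv\<^bsub>VB (Suc n)\<^esub> sig (Suc n) n))"
proof (rule threading_iff_exchange)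
  fix n :: nat assume n: "1 \<le> n"
  interpret H: group "VB (Suc n)" by (rule group_VB)
  show "inv\<^bsub>VB (Suc n)\<^esub> sig (Suc n) n \<in> carrier (VB (Suc n))"
    using n by (simp add: sig_closed)
  define G where "G = VB (Suc (Suc n))"
  interpret group G unfolding G_def by (rule group_VB)
  let ?v = "virt (Suc (Suc n)) n" and ?t = "virt (Suc (Suc n)) (Suc n)"
  let ?s = "sig (Suc (Suc n)) n" and ?T = "sig (Suc (Suc n)) (Suc n)"
  have c: "?v \<in> carrier G" "?t \<in> carrier G" "?s \<in> carrier G" "?T \<in> carrier G"
    using n by (auto simp: G_def intro: sig_closed virt_closed)
  have inv: "inv\<^bsub>G\<^esub> ?v = ?v" "inv\<^bsub>G\<^esub> ?t = ?t"
    using n by (simp_all add: G_def inv_virt)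
  have "?v \<otimes>\<^bsub>G\<^esub> ?T \<otimes>\<^bsub>G\<^esub> ?v = ?t \<otimes>\<^bsub>G\<^esub> ?s \<otimes>\<^bsub>G\<^esub> ?t"
    using n gen_mixed[of "sig (Suc (Suc n))" "Suc (Suc n)" n] by (simp add: G_def)
  then have "inv\<^bsub>G\<^esub> (?v \<otimes>\<^bsub>G\<^esub> ?T \<otimes>\<^bsub>G\<^esub> ?v) = inv\<^bsub>G\<^esub> (?t \<otimes>\<^bsub>G\<^esub> ?s \<otimes>\<^bsub>G\<^esub> ?t)" by simp
  then have "?v \<otimes>\<^bsub>G\<^esub> inv\<^bsub>G\<^esub> ?T \<otimes>\<^bsub>G\<^esub> ?v = ?t \<otimes>\<^bsub>G\<^esub> inv\<^bsub>G\<^esub> ?s \<otimes>\<^bsub>G\<^esub> ?t"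
    using c by (simp add: inv_mult_group inv m_assoc)
  then show "?v \<otimes>\<^bsub>VB (Suc (Suc n))\<^esub> inv\<^bsub>VB (Suc (Suc n))\<^esub> ?T \<otimes>\<^bsub>VB (Suc (Suc n))\<^esub> ?v
      = ?t \<otimes>\<^bsub>VB (Suc (Suc n))\<^esub> VB_right (Suc n) (inv\<^bsub>VB (Suc n)\<^esub> sig (Suc n) n) \<otimes>\<^bsub>VB (Suc (Suc n))\<^esub> ?t"
    using n VB_right_sig[of n "Suc n"] by (simp add: G_def VB_right_inv sig_closed)
  fix b assume b: "b \<in> carrier (VB n)"
  then have r: "VB_right (Suc n) (VB_right n b) \<in> carrier G"
    by (simp add: G_def VB_right_closed)
  show "inv\<^bsub>VB (Suc (Suc n))\<^esub> ?T \<otimes>\<^bsub>VB (Suc (Suc n))\<^esub> VB_right (Suc n) (VB_right n b)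
       = VB_right (Suc n) (VB_right n b) \<otimes>\<^bsub>VB (Suc (Suc n))\<^esub> inv\<^bsub>VB (Suc (Suc n))\<^esub> ?T"
    using inv_intertwine[OF r c(4) c(4)] commute_last[OF b, of "sig (Suc (Suc n))"]
    by (simp add: G_def)
qed

lemma left_crossing_threading_iff_exchange:
  "(\<forall>n\<ge>2. threading R n (left_crossing n)) \<longleftrightarrow> (\<forall>n\<ge>1. exchange R n (left_crossing n))"
proof (rule threading_iff_exchange)
  fix n :: nat assume n: "1 \<le> n"
  show "left_crossing n \<in> carrier (VB (Suc n))" using n by (rule left_crossing_closed)
  define G where "G = VB (Suc (Suc n))"
  interpret group G unfolding G_def by (rule group_VB)
  define v t s T where defs: "v = virt (Suc (Suc n)) n" "t = virt (Suc (Suc n)) (Suc n)"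
    "s = sig (Suc (Suc n)) n" "T = sig (Suc (Suc n)) (Suc n)"
  have c: "v \<in> carrier G" "t \<in> carrier G" "s \<in> carrier G" "T \<in> carrier G"
    using n by (auto simp: G_def defs intro: sig_closed virt_closed)
  have inv: "v \<otimes>\<^bsub>G\<^esub> v = \<one>\<^bsub>G\<^esub>" "t \<otimes>\<^bsub>G\<^esub> t = \<one>\<^bsub>G\<^esub>"
    using n by (simp_all add: G_def defs virt_virt)
  have mixed: "t \<otimes>\<^bsub>G\<^esub> v \<otimes>\<^bsub>G\<^esub> T = s \<otimes>\<^bsub>G\<^esub> t \<otimes>\<^bsub>G\<^esub> v"
    using n gen_slide(1)[of "sig (Suc (Suc n))" "Suc (Suc n)" n] by (simp add: G_def defs)
  have braid: "v \<otimes>\<^bsub>G\<^esub> t \<otimes>\<^bsub>G\<^esub> v = t \<otimes>\<^bsub>G\<^esub> v \<otimes>\<^bsub>G\<^esub> t"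
    using n gen_mixed[of "virt (Suc (Suc n))" "Suc (Suc n)" n] by (simp add: G_def defs)
  have r: "VB_right (Suc n) (left_crossing n) = v \<otimes>\<^bsub>G\<^esub> s \<otimes>\<^bsub>G\<^esub> v"
    using n VB_right_sig[of n "Suc n"] VB_right_virt[of n "Suc n"] group.is_monoid[OF group_VB, of "Suc n"]
    by (simp add: left_crossing_def VB_right_mult sig_closed virt_closed monoid.m_closed G_def defs)
  have lc: "left_crossing (Suc n) = t \<otimes>\<^bsub>G\<^esub> T \<otimes>\<^bsub>G\<^esub> t" by (simp add: left_crossing_def G_def defs)
  have tt: "t \<otimes>\<^bsub>G\<^esub> (t \<otimes>\<^bsub>G\<^esub> x) = x" "v \<otimes>\<^bsub>G\<^esub> (v \<otimes>\<^bsub>G\<^esub> x) = x" if "x \<in> carrier G" for x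
    using that c inv by (simp_all flip: m_assoc)
  have "v \<otimes>\<^bsub>G\<^esub> (t \<otimes>\<^bsub>G\<^esub> T \<otimes>\<^bsub>G\<^esub> t) \<otimes>\<^bsub>G\<^esub> v = (v \<otimes>\<^bsub>G\<^esub> t \<otimes>\<^bsub>G\<^esub> v) \<otimes>\<^bsub>G\<^esub> v \<otimes>\<^bsub>G\<^esub> T \<otimes>\<^bsub>G\<^esub> t \<otimes>\<^bsub>G\<^esub> v"
    using c by (simp add: m_assoc tt)
  also have "\<dots> = t \<otimes>\<^bsub>G\<^esub> v \<otimes>\<^bsub>G\<^esub> (t \<otimes>\<^bsub>G\<^esub> v \<otimes>\<^bsub>G\<^esub> T) \<otimes>\<^bsub>G\<^esub> t \<otimes>\<^bsub>G\<^esub> v"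
    unfolding braid using c by (simp add: m_assoc)
  also have "\<dots> = t \<otimes>\<^bsub>G\<^esub> v \<otimes>\<^bsub>G\<^esub> s \<otimes>\<^bsub>G\<^esub> t \<otimes>\<^bsub>G\<^esub> (v \<otimes>\<^bsub>G\<^esub> t \<otimes>\<^bsub>G\<^esub> v)"
    unfolding mixed using c by (simp add: m_assoc)
  also have "\<dots> = t \<otimes>\<^bsub>G\<^esub> (v \<otimes>\<^bsub>G\<^esub> s \<otimes>\<^bsub>G\<^esub> v) \<otimes>\<^bsub>G\<^esub> t"
    unfolding braid using c by (simp add: m_assoc tt)
  finally show "virt (Suc (Suc n)) n \<otimes>\<^bsub>VB (Suc (Suc n))\<^esub> left_crossing (Suc n) \<otimes>\<^bsub>VB (Suc (Suc n))\<^esub> virt (Suc (Suc n)) n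
      = virt (Suc (Suc n)) (Suc n) \<otimes>\<^bsub>VB (Suc (Suc n))\<^esub> VB_right (Suc n) (left_crossing n)
          \<otimes>\<^bsub>VB (Suc (Suc n))\<^esub> virt (Suc (Suc n)) (Suc n)"
    unfolding r lc unfolding G_def defs .
  fix b' assume b': "b' \<in> carrier (VB n)"
  define b where "b = VB_right (Suc n) (VB_right n b')"
  have cb: "b \<in> carrier G" using b' by (simp add: b_def G_def VB_right_closed)
  have comm: "t \<otimes>\<^bsub>G\<^esub> b = b \<otimes>\<^bsub>G\<^esub> t" "T \<otimes>\<^bsub>G\<^esub> b = b \<otimes>\<^bsub>G\<^esub> T"
    using commute_last[OF b', of "virt (Suc (Suc n))"] commute_last[OF b', of "sig (Suc (Suc n))"]
    by (simp_all add: G_def b_def defs)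
  have "t \<otimes>\<^bsub>G\<^esub> T \<otimes>\<^bsub>G\<^esub> t \<otimes>\<^bsub>G\<^esub> b = t \<otimes>\<^bsub>G\<^esub> T \<otimes>\<^bsub>G\<^esub> (t \<otimes>\<^bsub>G\<^esub> b)"
    using c cb by (simp add: m_assoc)
  also have "\<dots> = t \<otimes>\<^bsub>G\<^esub> (T \<otimes>\<^bsub>G\<^esub> b) \<otimes>\<^bsub>G\<^esub> t"
    unfolding comm(1) using c cb by (simp add: m_assoc)
  also have "\<dots> = (t \<otimes>\<^bsub>G\<^esub> b) \<otimes>\<^bsub>G\<^esub> T \<otimes>\<^bsub>G\<^esub> t"
    unfolding comm(2) using c cb by (simp add: m_assoc)
  also have "\<dots> = b \<otimes>\<^bsub>G\<^esub> (t \<otimes>\<^bsub>G\<^esub> T \<otimes>\<^bsub>G\<^esub> t)"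
    unfolding comm(1) using c cb by (simp add: m_assoc)
  finally show "left_crossing (Suc n) \<otimes>\<^bsub>VB (Suc (Suc n))\<^esub> VB_right (Suc n) (VB_right n b')
       = VB_right (Suc n) (VB_right n b') \<otimes>\<^bsub>VB (Suc (Suc n))\<^esub> left_crossing (Suc n)"
    unfolding lc unfolding G_def b_def .
qed

text \<open>
  By \<open>left_threading_identity\<close>, the left threading of \<open>a\<close> is \<open>a u S u S\<^sup>-\<^sup>1 u\<close> with \<open>u = v\<^sub>n\<^sub>-\<^sub>1\<close> and
  \<open>S\<close> the left crossing. Conjugation with \<open>u\<close> makes it the threading of \<open>u a u\<close>, which is itself
  conjugate to \<open>a\<close>.
\<close>

lemma left_threading_iff:
  assumes n: "2 \<le> n"
  shows "left_threading R n \<longleftrightarrow> threading R n (left_crossing n)"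
proof -
  interpret H: group "VB n" by (rule group_VB)
  define G where "G = VB (Suc n)"
  interpret group G unfolding G_def by (rule group_VB)
  define w u v s T where defs: "w = virt n (n - 1)" "u = virt (Suc n) (n - 1)" "v = virt (Suc n) n"
    "s = sig (Suc n) (n - 1)" "T = sig (Suc n) n"
  have c: "u \<in> carrier G" "v \<in> carrier G" "s \<in> carrier G" "T \<in> carrier G" "w \<in> carrier (VB n)"
    using n by (auto simp: G_def defs intro: sig_closed virt_closed)
  have inv: "u \<otimes>\<^bsub>G\<^esub> u = \<one>\<^bsub>G\<^esub>" "v \<otimes>\<^bsub>G\<^esub> v = \<one>\<^bsub>G\<^esub>" "w \<otimes>\<^bsub>VB n\<^esub> w = \<one>\<^bsub>VB n\<^esub>"
    using n by (simp_all add: G_def defs virt_virt)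
  have rw: "VB_right n w = u"
    using n VB_right_virt[of "n - 1" n] by (simp add: defs)
  have id: "v \<otimes>\<^bsub>G\<^esub> u \<otimes>\<^bsub>G\<^esub> s \<otimes>\<^bsub>G\<^esub> v \<otimes>\<^bsub>G\<^esub> inv\<^bsub>G\<^esub> s \<otimes>\<^bsub>G\<^esub> u \<otimes>\<^bsub>G\<^esub> v
     = u \<otimes>\<^bsub>G\<^esub> (v \<otimes>\<^bsub>G\<^esub> T \<otimes>\<^bsub>G\<^esub> v) \<otimes>\<^bsub>G\<^esub> u \<otimes>\<^bsub>G\<^esub> inv\<^bsub>G\<^esub> (v \<otimes>\<^bsub>G\<^esub> T \<otimes>\<^bsub>G\<^esub> v) \<otimes>\<^bsub>G\<^esub> u"
    using n gen_mixed[of _ "Suc n" "n - 1"]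
    by (intro left_threading_identity c inv) (simp_all add: G_def defs)
  have lc: "left_crossing n = v \<otimes>\<^bsub>G\<^esub> T \<otimes>\<^bsub>G\<^esub> v" by (simp add: left_crossing_def G_def defs)
  \<comment> \<open>\<open>L\<close> is the left threading of a braid, \<open>C\<close> its threading with the left crossing.\<close>
  define L where "L a = VB_right n a \<otimes>\<^bsub>G\<^esub> v \<otimes>\<^bsub>G\<^esub> u \<otimes>\<^bsub>G\<^esub> s \<otimes>\<^bsub>G\<^esub> v \<otimes>\<^bsub>G\<^esub> inv\<^bsub>G\<^esub> s \<otimes>\<^bsub>G\<^esub> u \<otimes>\<^bsub>G\<^esub> v" for a
  define C where "C a = VB_right n a \<otimes>\<^bsub>G\<^esub> left_crossing n \<otimes>\<^bsub>G\<^esub> u \<otimes>\<^bsub>G\<^esub> inv\<^bsub>G\<^esub> left_crossing n" for a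
  have conj_w: "(n, w \<otimes>\<^bsub>VB n\<^esub> a \<otimes>\<^bsub>VB n\<^esub> w) \<sim> (n, a)" if a: "a \<in> carrier (VB n)" for a
    using n a c inv by (intro intertwined[of n w]) (simp_all flip: H.m_assoc)
  have LC: "(Suc n, C (w \<otimes>\<^bsub>VB n\<^esub> a \<otimes>\<^bsub>VB n\<^esub> w)) \<sim> (Suc n, L a)" if a: "a \<in> carrier (VB n)" for a
  proof -
    have ra: "VB_right n a \<in> carrier G" using a by (simp add: G_def VB_right_closed)
    have L: "L a = VB_right n a \<otimes>\<^bsub>G\<^esub> u \<otimes>\<^bsub>G\<^esub> left_crossing n \<otimes>\<^bsub>G\<^esub> u \<otimes>\<^bsub>G\<^esub> inv\<^bsub>G\<^esub> left_crossing n \<otimes>\<^bsub>G\<^esub> u"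
    proof -
      have "L a = VB_right n a \<otimes>\<^bsub>G\<^esub> (v \<otimes>\<^bsub>G\<^esub> u \<otimes>\<^bsub>G\<^esub> s \<otimes>\<^bsub>G\<^esub> v \<otimes>\<^bsub>G\<^esub> inv\<^bsub>G\<^esub> s \<otimes>\<^bsub>G\<^esub> u \<otimes>\<^bsub>G\<^esub> v)"
        using ra c by (simp add: L_def m_assoc)
      then show ?thesis unfolding id lc using ra c by (simp add: m_assoc)
    qed
    have C: "C (w \<otimes>\<^bsub>VB n\<^esub> a \<otimes>\<^bsub>VB n\<^esub> w)
        = u \<otimes>\<^bsub>G\<^esub> (VB_right n a \<otimes>\<^bsub>G\<^esub> u \<otimes>\<^bsub>G\<^esub> left_crossing n \<otimes>\<^bsub>G\<^esub> u \<otimes>\<^bsub>G\<^esub> inv\<^bsub>G\<^esub> left_crossing n)"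
      unfolding C_def lc using a ra c by (simp add: VB_right_mult rw m_assoc flip: G_def)
    show ?thesis
      unfolding L C unfolding G_def by (rule cyclic) (use n ra c in \<open>auto simp: lc simp flip: G_def\<close>)
  qed
  have "(n, a) \<sim> (Suc n, L a) \<longleftrightarrow> (n, w \<otimes>\<^bsub>VB n\<^esub> a \<otimes>\<^bsub>VB n\<^esub> w) \<sim> (Suc n, C (w \<otimes>\<^bsub>VB n\<^esub> a \<otimes>\<^bsub>VB n\<^esub> w))"
    if "a \<in> carrier (VB n)" for a
    using conj_w[OF that] LC[OF that] sym trans by meson
  moreover have "\<exists>b\<in>carrier (VB n). a = w \<otimes>\<^bsub>VB n\<^esub> b \<otimes>\<^bsub>VB n\<^esub> w" if "a \<in> carrier (VB n)" for a
  proof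
    have "w \<otimes>\<^bsub>VB n\<^esub> (w \<otimes>\<^bsub>VB n\<^esub> x) = x" if "x \<in> carrier (VB n)" for x
      using that c inv by (simp flip: H.m_assoc)
    then show "a = w \<otimes>\<^bsub>VB n\<^esub> (w \<otimes>\<^bsub>VB n\<^esub> a \<otimes>\<^bsub>VB n\<^esub> w) \<otimes>\<^bsub>VB n\<^esub> w"
      using that c inv by (simp add: H.m_assoc)
  qed (use that c in simp)
  moreover have "w \<otimes>\<^bsub>VB n\<^esub> a \<otimes>\<^bsub>VB n\<^esub> w \<in> carrier (VB n)" if "a \<in> carrier (VB n)" for a
    using that c by simp
  ultimately have "(\<forall>a\<in>carrier (VB n). (n, a) \<sim> (Suc n, L a)) \<longleftrightarrow> (\<forall>a\<in>carrier (VB n). (n, a) \<sim> (Suc n, C a))"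
    by metis
  then show ?thesis
    by (simp add: left_threading_def threading_def L_def C_def G_def defs)
qed

text \<open>
  Conjugation with the product \<open>h\<close> of two cycles takes \<open>i(a) \<sigma>\<^sub>1\<^sup>-\<^sup>1 i(b) \<sigma>\<^sub>1\<close> to
  \<open>a' S\<^sup>-\<^sup>1 b' S\<close>, where \<open>a'\<close> and \<open>b'\<close> are conjugates of \<open>a\<close> and \<open>b\<close> by a fixed element of \<open>VB\<^sub>n\<close>,
  hence as arbitrary as these. A cyclic rotation then puts \<open>S\<close> in front of its inverse, at the price of
  interchanging \<open>a'\<close> and \<open>b'\<close>.
\<close>

lemma left_exchange_iff:
  assumes n: "1 \<le> n"
  shows "left_exchange R n \<longleftrightarrow> exchange R n (left_crossing n)"
proof -
  interpret H: group "VB n" by (rule group_VB)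
  define G where "G = VB (Suc n)"
  interpret group G unfolding G_def by (rule group_VB)
  define r v s v1 s1 S where defs: "r = virt_cycle n (n - 1)" "v = virt (Suc n) n" "s = sig (Suc n) n"
    "v1 = virt (Suc n) 1" "s1 = sig (Suc n) 1" "S = left_crossing n"
  define h where "h = virt_cycle (Suc n) (n - 1) \<otimes>\<^bsub>G\<^esub> virt_cycle (Suc n) n"
  define c where "c b = r \<otimes>\<^bsub>VB n\<^esub> b \<otimes>\<^bsub>VB n\<^esub> inv\<^bsub>VB n\<^esub> r" for b
  have carr: "r \<in> carrier (VB n)" "v \<in> carrier G" "s \<in> carrier G" "v1 \<in> carrier G" "s1 \<in> carrier G"
    "S \<in> carrier G" "h \<in> carrier G"
  proof -
    have "virt_cycle (Suc n) (n - 1) \<in> carrier G" "virt_cycle (Suc n) n \<in> carrier G"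
      unfolding G_def using n by (auto intro: virt_cycle_closed)
    then show "h \<in> carrier G" by (simp add: h_def)
  qed (use n in \<open>auto simp: G_def defs intro: sig_closed virt_closed virt_cycle_closed left_crossing_closed\<close>)
  have c: "c b \<in> carrier (VB n)" if "b \<in> carrier (VB n)" for b
    using that carr by (simp add: c_def)
  have surj: "\<exists>b\<in>carrier (VB n). a = c b" if "a \<in> carrier (VB n)" for a
  proof
    have "r \<otimes>\<^bsub>VB n\<^esub> (inv\<^bsub>VB n\<^esub> r \<otimes>\<^bsub>VB n\<^esub> x) = x" if "x \<in> carrier (VB n)" for x
      using that carr by (simp flip: H.m_assoc)
    then show "a = c (inv\<^bsub>VB n\<^esub> r \<otimes>\<^bsub>VB n\<^esub> a \<otimes>\<^bsub>VB n\<^esub> r)"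
      using that carr by (simp add: c_def H.m_assoc)
  qed (use that carr in simp)
  have inv: "v \<otimes>\<^bsub>G\<^esub> v = \<one>\<^bsub>G\<^esub>" using n by (simp add: defs G_def virt_virt)
  have hv: "h \<otimes>\<^bsub>G\<^esub> v1 = v \<otimes>\<^bsub>G\<^esub> h" and hs: "h \<otimes>\<^bsub>G\<^esub> s1 = S \<otimes>\<^bsub>G\<^esub> h"
  proof -
    show "h \<otimes>\<^bsub>G\<^esub> s1 = S \<otimes>\<^bsub>G\<^esub> h"
      using n virt_cycle_virt_cycle_first[of "sig (Suc n)" "Suc n" "n - 1"]
      by (simp add: h_def defs left_crossing_def G_def)
    have "h \<otimes>\<^bsub>G\<^esub> v1 = v \<otimes>\<^bsub>G\<^esub> v \<otimes>\<^bsub>G\<^esub> v \<otimes>\<^bsub>G\<^esub> h"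
      using n virt_cycle_virt_cycle_first[of "virt (Suc n)" "Suc n" "n - 1"]
      by (simp add: h_def defs G_def)
    then show "h \<otimes>\<^bsub>G\<^esub> v1 = v \<otimes>\<^bsub>G\<^esub> h" using carr by (simp add: inv)
  qed
  have carrLR: "VB_left n b \<in> carrier G" "VB_right n b \<in> carrier G" if "b \<in> carrier (VB n)" for b
    using that by (simp_all add: G_def VB_left_closed VB_right_closed)
  have hL: "h \<otimes>\<^bsub>G\<^esub> VB_left n b = VB_right n (c b) \<otimes>\<^bsub>G\<^esub> h" if "b \<in> carrier (VB n)" for b
    using VB_left_conj[OF n that] by (simp add: h_def c_def defs G_def)
  have conj4: "(Suc n, a \<otimes>\<^bsub>G\<^esub> x \<otimes>\<^bsub>G\<^esub> b \<otimes>\<^bsub>G\<^esub> y) \<sim> (Suc n, a' \<otimes>\<^bsub>G\<^esub> x' \<otimes>\<^bsub>G\<^esub> b' \<otimes>\<^bsub>G\<^esub> y')"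
    if cs: "a \<in> carrier G" "x \<in> carrier G" "b \<in> carrier G" "y \<in> carrier G"
        "a' \<in> carrier G" "x' \<in> carrier G" "b' \<in> carrier G" "y' \<in> carrier G"
      and h: "h \<otimes>\<^bsub>G\<^esub> a = a' \<otimes>\<^bsub>G\<^esub> h" "h \<otimes>\<^bsub>G\<^esub> x = x' \<otimes>\<^bsub>G\<^esub> h" "h \<otimes>\<^bsub>G\<^esub> b = b' \<otimes>\<^bsub>G\<^esub> h" "h \<otimes>\<^bsub>G\<^esub> y = y' \<otimes>\<^bsub>G\<^esub> h"
    for a x b y a' x' b' y'
  proof -
    have h': "h \<otimes>\<^bsub>G\<^esub> (a \<otimes>\<^bsub>G\<^esub> z) = a' \<otimes>\<^bsub>G\<^esub> (h \<otimes>\<^bsub>G\<^esub> z)" "h \<otimes>\<^bsub>G\<^esub> (x \<otimes>\<^bsub>G\<^esub> z) = x' \<otimes>\<^bsub>G\<^esub> (h \<otimes>\<^bsub>G\<^esub> z)"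
        "h \<otimes>\<^bsub>G\<^esub> (b \<otimes>\<^bsub>G\<^esub> z) = b' \<otimes>\<^bsub>G\<^esub> (h \<otimes>\<^bsub>G\<^esub> z)" if "z \<in> carrier G" for z
      using that cs h carr by (simp_all flip: m_assoc)
    have "h \<otimes>\<^bsub>G\<^esub> (a \<otimes>\<^bsub>G\<^esub> x \<otimes>\<^bsub>G\<^esub> b \<otimes>\<^bsub>G\<^esub> y) = a' \<otimes>\<^bsub>G\<^esub> x' \<otimes>\<^bsub>G\<^esub> b' \<otimes>\<^bsub>G\<^esub> y' \<otimes>\<^bsub>G\<^esub> h"
      using cs carr by (simp add: m_assoc h' h)
    then show ?thesis
      unfolding G_def by (intro intertwined[of _ h]) (use cs carr in \<open>auto simp flip: G_def\<close>)
  qed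
  have lhs: "(Suc n, VB_left n a \<otimes>\<^bsub>G\<^esub> inv\<^bsub>G\<^esub> s1 \<otimes>\<^bsub>G\<^esub> VB_left n b \<otimes>\<^bsub>G\<^esub> s1)
      \<sim> (Suc n, VB_right n (c b) \<otimes>\<^bsub>G\<^esub> S \<otimes>\<^bsub>G\<^esub> VB_right n (c a) \<otimes>\<^bsub>G\<^esub> inv\<^bsub>G\<^esub> S)"
    and rhs: "(Suc n, VB_left n a \<otimes>\<^bsub>G\<^esub> v1 \<otimes>\<^bsub>G\<^esub> VB_left n b \<otimes>\<^bsub>G\<^esub> v1)
      \<sim> (Suc n, VB_right n (c b) \<otimes>\<^bsub>G\<^esub> v \<otimes>\<^bsub>G\<^esub> VB_right n (c a) \<otimes>\<^bsub>G\<^esub> v)"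
    if a: "a \<in> carrier (VB n)" and b: "b \<in> carrier (VB n)" for a b
  proof -
    note ca = carrLR[OF a] carrLR[OF b] carrLR(2)[OF c[OF a]] carrLR(2)[OF c[OF b]]
    have swap: "(Suc n, VB_right n (c a) \<otimes>\<^bsub>G\<^esub> x \<otimes>\<^bsub>G\<^esub> VB_right n (c b) \<otimes>\<^bsub>G\<^esub> y)
       \<sim> (Suc n, VB_right n (c b) \<otimes>\<^bsub>G\<^esub> y \<otimes>\<^bsub>G\<^esub> VB_right n (c a) \<otimes>\<^bsub>G\<^esub> x)"
      if "x \<in> carrier G" "y \<in> carrier G" for x y
      using cyclic[of "Suc n" "VB_right n (c a) \<otimes>\<^bsub>G\<^esub> x" "VB_right n (c b) \<otimes>\<^bsub>G\<^esub> y"] that ca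
      by (simp add: m_assoc flip: G_def)
    show "(Suc n, VB_left n a \<otimes>\<^bsub>G\<^esub> inv\<^bsub>G\<^esub> s1 \<otimes>\<^bsub>G\<^esub> VB_left n b \<otimes>\<^bsub>G\<^esub> s1)
      \<sim> (Suc n, VB_right n (c b) \<otimes>\<^bsub>G\<^esub> S \<otimes>\<^bsub>G\<^esub> VB_right n (c a) \<otimes>\<^bsub>G\<^esub> inv\<^bsub>G\<^esub> S)"
      by (rule trans[OF conj4 swap])
         (use ca carr hL[OF a] hL[OF b] hs inv_intertwine[OF _ _ _ hs] in auto)
    show "(Suc n, VB_left n a \<otimes>\<^bsub>G\<^esub> v1 \<otimes>\<^bsub>G\<^esub> VB_left n b \<otimes>\<^bsub>G\<^esub> v1)
      \<sim> (Suc n, VB_right n (c b) \<otimes>\<^bsub>G\<^esub> v \<otimes>\<^bsub>G\<^esub> VB_right n (c a) \<otimes>\<^bsub>G\<^esub> v)"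
      by (rule trans[OF conj4 swap]) (use ca carr hL[OF a] hL[OF b] hv in auto)
  qed
  define P where "P a b \<longleftrightarrow> (Suc n, VB_right n a \<otimes>\<^bsub>G\<^esub> S \<otimes>\<^bsub>G\<^esub> VB_right n b \<otimes>\<^bsub>G\<^esub> inv\<^bsub>G\<^esub> S)
      \<sim> (Suc n, VB_right n a \<otimes>\<^bsub>G\<^esub> v \<otimes>\<^bsub>G\<^esub> VB_right n b \<otimes>\<^bsub>G\<^esub> v)" for a b
  have "(Suc n, VB_left n a \<otimes>\<^bsub>G\<^esub> inv\<^bsub>G\<^esub> s1 \<otimes>\<^bsub>G\<^esub> VB_left n b \<otimes>\<^bsub>G\<^esub> s1)
      \<sim> (Suc n, VB_left n a \<otimes>\<^bsub>G\<^esub> v1 \<otimes>\<^bsub>G\<^esub> VB_left n b \<otimes>\<^bsub>G\<^esub> v1) \<longleftrightarrow> P (c b) (c a)"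
    if "a \<in> carrier (VB n)" "b \<in> carrier (VB n)" for a b
    using lhs[OF that] rhs[OF that] sym trans unfolding P_def by meson
  then have "left_exchange R n \<longleftrightarrow> (\<forall>a\<in>carrier (VB n). \<forall>b\<in>carrier (VB n). P (c b) (c a))"
    by (simp add: left_exchange_def G_def defs)
  also have "\<dots> \<longleftrightarrow> (\<forall>a\<in>carrier (VB n). \<forall>b\<in>carrier (VB n). P a b)"
  proof (intro iffI ballI)
    fix a b assume *: "\<forall>a\<in>carrier (VB n). \<forall>b\<in>carrier (VB n). P (c b) (c a)"
      and ab: "a \<in> carrier (VB n)" "b \<in> carrier (VB n)"
    obtain a' b' where "a' \<in> carrier (VB n)" "a = c a'" "b' \<in> carrier (VB n)" "b = c b'"
      using surj[OF ab(1)] surj[OF ab(2)] by blast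
    with * show "P a b" by simp
  qed (use c in simp)
  also have "\<dots> \<longleftrightarrow> exchange R n (left_crossing n)"
    by (simp add: exchange_def P_def G_def defs)
  finally show ?thesis .
qed

lemma left_threading_iff_exchange:
  "(\<forall>n\<ge>2. left_threading R n) \<longleftrightarrow> (\<forall>n\<ge>1. left_exchange R n)"
  using left_crossing_threading_iff_exchange left_threading_iff left_exchange_iff by simp

end

section \<open>The two lists of moves\<close>

text \<open>
  The elements with which an equivalence relation admits conjugation form a subgroup. So conjugation with
  generators, as in the algebraic list, gives all conjugations of the list of Kamada.
\<close>

lemma conj_generated:
  assumes R: "equivp R"
    and sig: "\<And>i b. 1 \<le> i \<Longrightarrow> i < n \<Longrightarrow> b \<in> carrier (VB n) \<Longrightarrow>
      R (n, b) (n, inv\<^bsub>VB n\<^esub> sig n i \<otimes>\<^bsub>VB n\<^esub> b \<otimes>\<^bsub>VB n\<^esub> sig n i)"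
    and virt: "\<And>i b. 1 \<le> i \<Longrightarrow> i < n \<Longrightarrow> b \<in> carrier (VB n) \<Longrightarrow>
      R (n, b) (n, inv\<^bsub>VB n\<^esub> virt n i \<otimes>\<^bsub>VB n\<^esub> b \<otimes>\<^bsub>VB n\<^esub> virt n i)"
    and b: "b \<in> carrier (VB n)" and g: "g \<in> carrier (VB n)"
  shows "R (n, b) (n, inv\<^bsub>VB n\<^esub> g \<otimes>\<^bsub>VB n\<^esub> b \<otimes>\<^bsub>VB n\<^esub> g)"
proof -
  interpret group "VB n" by (rule group_VB)
  let ?c = "\<lambda>g b. inv\<^bsub>VB n\<^esub> g \<otimes>\<^bsub>VB n\<^esub> b \<otimes>\<^bsub>VB n\<^esub> g"
  let ?H = "{g \<in> carrier (VB n). \<forall>b\<in>carrier (VB n). R (n, b) (n, ?c g b)}"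
  have "subgroup ?H (VB n)"
  proof (rule subgroupI)
    show "?H \<noteq> {}" using equivp_reflp[OF R] by (auto intro!: exI[of _ "\<one>\<^bsub>VB n\<^esub>"])
  next
    fix g assume "g \<in> ?H"
    then have g: "g \<in> carrier (VB n)" and *: "\<And>b. b \<in> carrier (VB n) \<Longrightarrow> R (n, b) (n, ?c g b)" by auto
    have "R (n, b) (n, ?c (inv\<^bsub>VB n\<^esub> g) b)" if b: "b \<in> carrier (VB n)" for b
    proof -
      have "inv\<^bsub>VB n\<^esub> g \<otimes>\<^bsub>VB n\<^esub> (g \<otimes>\<^bsub>VB n\<^esub> x) = x" if "x \<in> carrier (VB n)" for x
        using that g by (simp flip: m_assoc)
      then have "?c g (?c (inv\<^bsub>VB n\<^esub> g) b) = b" using g b by (simp add: m_assoc)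
      then show ?thesis using *[of "?c (inv\<^bsub>VB n\<^esub> g) b"] g b equivp_symp[OF R] by simp
    qed
    then show "inv\<^bsub>VB n\<^esub> g \<in> ?H" using g by simp
  next
    fix g k assume "g \<in> ?H" "k \<in> ?H"
    then have c: "g \<in> carrier (VB n)" "k \<in> carrier (VB n)"
      and *: "\<And>b. b \<in> carrier (VB n) \<Longrightarrow> R (n, b) (n, ?c g b)"
        "\<And>b. b \<in> carrier (VB n) \<Longrightarrow> R (n, b) (n, ?c k b)" by auto
    have "R (n, b) (n, ?c (g \<otimes>\<^bsub>VB n\<^esub> k) b)" if b: "b \<in> carrier (VB n)" for b
    proof -
      have "R (n, b) (n, ?c k (?c g b))"
        using equivp_transp[OF R *(1)[OF b] *(2)[of "?c g b"]] b c by simp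
      also have "?c k (?c g b) = ?c (g \<otimes>\<^bsub>VB n\<^esub> k) b"
        using b c by (simp add: inv_mult_group m_assoc)
      finally show ?thesis .
    qed
    then show "g \<otimes>\<^bsub>VB n\<^esub> k \<in> ?H" using c by simp
  qed auto
  then have "?H = carrier (VB n)"
    by (rule VB_generators) (simp_all add: sig virt sig_closed virt_closed)
  then show ?thesis using b g by blast
qed

lemma equivp_equivclp: "equivp (equivclp r)"
  by (intro equivpI reflpI sympI transpI) (auto intro: equivclp_sym equivclp_trans)

interpretation kamada: markov_relation "equivclp kamada_move"
proof
  show "equivp (equivclp kamada_move)" by (rule equivp_equivclp)
qed (use kamada_move.conjugation kamada_move.right_stab_virt in \<open>auto intro!: r_into_equivclp\<close>)

interpretation algebraic: markov_relation "equivclp algebraic_move"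
proof
  show "equivp (equivclp algebraic_move)" by (rule equivp_equivclp)
  fix n b assume n: "1 \<le> n" and b: "b \<in> carrier (VB n)"
  show "equivclp algebraic_move (n, b) (Suc n, VB_right n b \<otimes>\<^bsub>VB (Suc n)\<^esub> virt (Suc n) n)"
    using algebraic_move.virt_stab[OF n b] by (auto intro: equivclp_sym r_into_equivclp)
  fix g assume g: "g \<in> carrier (VB n)"
  show "equivclp algebraic_move (n, b) (n, inv\<^bsub>VB n\<^esub> g \<otimes>\<^bsub>VB n\<^esub> b \<otimes>\<^bsub>VB n\<^esub> g)"
  proof (rule conj_generated[OF equivp_equivclp _ _ b g])
    fix i b assume i: "1 \<le> i" "i < n" and b: "b \<in> carrier (VB n)"
    show "equivclp algebraic_move (n, b) (n, inv\<^bsub>VB n\<^esub> sig n i \<otimes>\<^bsub>VB n\<^esub> b \<otimes>\<^bsub>VB n\<^esub> sig n i)"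
      using algebraic_move.real_conj[OF i b] by (rule r_into_equivclp)
    show "equivclp algebraic_move (n, b) (n, inv\<^bsub>VB n\<^esub> virt n i \<otimes>\<^bsub>VB n\<^esub> b \<otimes>\<^bsub>VB n\<^esub> virt n i)"
      unfolding inv_virt[OF i] using algebraic_move.virt_conj[OF i b]
      by (rule equivclp_sym[OF r_into_equivclp])
  qed
qed

lemma right_exchange_kamada:
  "1 \<le> n \<Longrightarrow> exchange (equivclp kamada_move) n (inv\<^bsub>VB (Suc n)\<^esub> sig (Suc n) n)"
  using kamada_move.right_exchange[of n]
  by (auto simp: exchange_def sig_closed group.inv_inv[OF group_VB] intro!: r_into_equivclp)

lemma left_exchange_kamada: "1 \<le> n \<Longrightarrow> left_exchange (equivclp kamada_move) n"
  using kamada_move.left_exchange[of n] by (auto simp: left_exchange_def intro!: r_into_equivclp)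

lemma right_threading_algebraic:
  "2 \<le> n \<Longrightarrow> threading (equivclp algebraic_move) n (inv\<^bsub>VB (Suc n)\<^esub> sig (Suc n) n)"
  using algebraic_move.right_under_threading[of n]
  by (auto simp: threading_def sig_closed group.inv_inv[OF group_VB] intro!: r_into_equivclp)

lemma left_threading_algebraic: "2 \<le> n \<Longrightarrow> left_threading (equivclp algebraic_move) n"
  using algebraic_move.left_under_threading[of n] by (auto simp: left_threading_def intro!: r_into_equivclp)

lemma kamada_imp_algebraic: "kamada_move x y \<Longrightarrow> equivclp algebraic_move x y"
proof (induction rule: kamada_move.induct)
  case (conjugation n b g)
  then show ?case by (rule algebraic.conj)
next
  case (right_stab_virt n b)
  then show ?case using algebraic.virt_stab by simp
next
  case (right_exchange n b1 b2)
  have "exchange (equivclp algebraic_move) n (inv\<^bsub>VB (Suc n)\<^esub> sig (Suc n) n)"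
    using algebraic.right_threading_iff_exchange right_threading_algebraic right_exchange(1) by blast
  then show ?case
    using right_exchange by (simp add: exchange_def sig_closed group.inv_inv[OF group_VB])
next
  case (left_exchange n b1 b2)
  have "left_exchange (equivclp algebraic_move) n"
    using algebraic.left_threading_iff_exchange left_threading_algebraic left_exchange(1) by blast
  then show ?case using left_exchange by (simp add: left_exchange_def)
qed (auto intro: r_into_equivclp algebraic_move.intros[simplified])

lemma algebraic_imp_kamada: "algebraic_move x y \<Longrightarrow> equivclp kamada_move x y"
proof (induction rule: algebraic_move.induct)
  case (virt_conj i n a)
  have "equivclp kamada_move (n, a) (n, inv\<^bsub>VB n\<^esub> virt n i \<otimes>\<^bsub>VB n\<^esub> a \<otimes>\<^bsub>VB n\<^esub> virt n i)"
    using virt_conj by (intro kamada.conj virt_closed) auto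
  then show ?case using virt_conj by (simp add: inv_virt equivclp_sym)
next
  case (real_conj i n a)
  then show ?case by (intro kamada.conj sig_closed) auto
next
  case (virt_stab n a)
  then show ?case using kamada.virt_stab by (simp add: equivclp_sym)
next
  case (right_under_threading n a)
  have "threading (equivclp kamada_move) n (inv\<^bsub>VB (Suc n)\<^esub> sig (Suc n) n)"
    using kamada.right_threading_iff_exchange right_exchange_kamada right_under_threading(1) by blast
  then show ?case
    using right_under_threading by (simp add: threading_def sig_closed group.inv_inv[OF group_VB])
next
  case (left_under_threading n a)
  have "left_threading (equivclp kamada_move) n"
    using kamada.left_threading_iff_exchange left_exchange_kamada left_under_threading(1) by blast
  then show ?case using left_under_threading by (simp add: left_threading_def)
qed (auto intro: r_into_equivclp kamada_move.intros[simplified])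

theorem proposition1:
  shows "(\<forall>x\<in>VB_inf. \<forall>y\<in>VB_inf. kamada_move x y \<longrightarrow> equivclp algebraic_move x y) \<and>
         (\<forall>x\<in>VB_inf. \<forall>y\<in>VB_inf. algebraic_move x y \<longrightarrow> equivclp kamada_move x y)"
  using kamada_imp_algebraic algebraic_imp_kamada by blast

end
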